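(* Let $n\ge 2$ and consider the Friends I process with $n$ players, with visiting probability matrices $p(t)=(p_{ij}(t))_{1\le i,j\le n}$. Then, almost surely, $p(t)$ converges as $t\to\infty$ to a random limit matrix $p$. The rows of $p$ are independent, and for each $i$ the $i$-th row of $p$, with its zero diagonal entry $p_{ii}=0$ removed, has the Dirichlet distribution on the simplex of probability vectors of length $n-1$ with all $n-1$ parameters equal to $1$.
   Context: Friends I process with $n$ players (agents) $1,\dots,n$: at each discrete time $t$ agent $i$ has a vector of weights $(w_{i1}(t),\dots,w_{in}(t))$ with $w_{ii}(t)=0$. Initially all weights $w_{ij}$ with $i\neq j$ equal $1$. In round $t$, every agent $i$ visits exactly one other agent; conditionally on the past, the agents make their choices independently, and agent $i$ visits agent $j$ with probability $p_{ij}(t)=w_{ij}(t)/\sum_k w_{ik}(t)$. Only the visitor is reinforced: $w_{ij}(t+1)=w_{ij}(t)+1$ if $i$ visited $j$ in round $t$, and $w_{ij}(t+1)=w_{ij}(t)$ otherwise. *)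

theory Defs
  imports "HOL-Probability.Probability"
begin

text \<open>Players are \<open>1, \<dots>, n\<close>; \<open>V t i \<omega>\<close> is the player visited by \<open>i\<close> in round \<open>t = 0, 1, \<dots>\<close>,
  and \<open>weight V t i j\<close> is the weight \<open>w\<^sub>i\<^sub>j\<close> just before round \<open>t\<close>.\<close>

primrec weight :: "(nat \<Rightarrow> nat \<Rightarrow> 'a \<Rightarrow> nat) \<Rightarrow> nat \<Rightarrow> nat \<Rightarrow> nat \<Rightarrow> 'a \<Rightarrow> real" where
  "weight V 0 i j \<omega> = (if i = j then 0 else 1)"
| "weight V (Suc t) i j \<omega> = weight V t i j \<omega> + (if V t i \<omega> = j then 1 else 0)"

definition visit_prob ::
    "nat \<Rightarrow> (nat \<Rightarrow> nat \<Rightarrow> 'a \<Rightarrow> nat) \<Rightarrow> nat \<Rightarrow> nat \<Rightarrow> nat \<Rightarrow> 'a \<Rightarrow> real" where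
  "visit_prob n V t i j \<omega> = weight V t i j \<omega> / (\<Sum>k\<in>{1..n}. weight V t i k \<omega>)"

definition past :: "'a measure \<Rightarrow> nat \<Rightarrow> (nat \<Rightarrow> nat \<Rightarrow> 'a \<Rightarrow> nat) \<Rightarrow> nat \<Rightarrow> 'a measure" where
  "past M n V t = vimage_algebra (space M)
     (\<lambda>\<omega>. \<lambda>(s, i)\<in>{..<t} \<times> {1..n}. V s i \<omega>)
     (Pi\<^sub>M ({..<t} \<times> {1..n}) (\<lambda>_. count_space UNIV))"

text \<open>The assumption \<open>choices\<close> states that, given the past, the joint law of the choices is
  the product of the laws \<open>(p\<^sub>i\<^sub>j(t))\<^sub>j\<close>; \<open>visits\<close> includes that nobody visits themselves, so that
  the weights \<open>w\<^sub>i\<^sub>i\<close> stay zero.\<close>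

locale friends_I = prob_space M
  for M :: "'a measure" and n :: nat and V :: "nat \<Rightarrow> nat \<Rightarrow> 'a \<Rightarrow> nat" +
  assumes visits: "\<And>t i. i \<in> {1..n} \<Longrightarrow> V t i \<in> M \<rightarrow>\<^sub>M count_space ({1..n} - {i})"
    and choices: "\<And>t c. c \<in> {1..n} \<rightarrow> {1..n} \<Longrightarrow>
      AE \<omega> in M. real_cond_exp M (past M n V t)
          (indicator {\<omega> \<in> space M. \<forall>i\<in>{1..n}. V t i \<omega> = c i}) \<omega>
        = (\<Prod>i\<in>{1..n}. visit_prob n V t i (c i) \<omega>)"

text \<open>Hence \<open>real_cond_exp\<close> in \<open>choices\<close> is a genuine conditional expectation and not its
  default value \<open>0\<close>.\<close>

lemma (in friends_I) past_subalgebra: "subalgebra M (past M n V t)"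
proof -
  have "V s i \<in> M \<rightarrow>\<^sub>M count_space UNIV" if "i \<in> {1..n}" for s i
    using measurable_compose[OF visits[OF that, of s], of id "count_space UNIV"] by simp
  then have "(\<lambda>\<omega>. \<lambda>(s, i)\<in>{..<t} \<times> {1..n}. V s i \<omega>)
      \<in> M \<rightarrow>\<^sub>M Pi\<^sub>M ({..<t} \<times> {1..n}) (\<lambda>_. count_space UNIV)"
    by (intro measurable_restrict) auto
  from measurable_sets[OF this] show ?thesis
    unfolding past_def
    by (auto simp: subalgebra_def sets_vimage_algebra intro!: sets.sigma_sets_subset)
qed

text \<open>Dirichlet distribution of length \<open>k \<ge> 1\<close> with parameters \<open>\<alpha> 1, \<dots>, \<alpha> k > 0\<close>, given by its
  usual density in the first \<open>k - 1\<close> coordinates. Requiring strict positivity discards only a null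
  set and avoids \<open>0 powr 0 = 0\<close>. For \<open>k = 1\<close> this is the point mass at the vector \<open>(1)\<close>.\<close>

definition add_last :: "nat \<Rightarrow> (nat \<Rightarrow> real) \<Rightarrow> nat \<Rightarrow> real" where
  "add_last k x = x(k := 1 - (\<Sum>j\<in>{1..<k}. x j))"

definition dirichlet_density :: "nat \<Rightarrow> (nat \<Rightarrow> real) \<Rightarrow> (nat \<Rightarrow> real) \<Rightarrow> real" where
  "dirichlet_density k \<alpha> y =
     (if \<forall>j\<in>{1..k}. 0 < y j
      then Gamma (\<Sum>j\<in>{1..k}. \<alpha> j) / (\<Prod>j\<in>{1..k}. Gamma (\<alpha> j))
             * (\<Prod>j\<in>{1..k}. y j powr (\<alpha> j - 1))
      else 0)"

definition dirichlet :: "nat \<Rightarrow> (nat \<Rightarrow> real) \<Rightarrow> (nat \<Rightarrow> real) measure" where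
  "dirichlet k \<alpha> =
     distr (density (Pi\<^sub>M {1..<k} (\<lambda>_. lborel)) (\<lambda>x. ennreal (dirichlet_density k \<alpha> (add_last k x))))
       (Pi\<^sub>M {1..k} (\<lambda>_. borel)) (add_last k)"

definition remove_entry :: "nat \<Rightarrow> nat \<Rightarrow> (nat \<Rightarrow> real) \<Rightarrow> nat \<Rightarrow> real" where
  "remove_entry n i x = (\<lambda>j\<in>{1..n - 1}. x (if j < i then j else j + 1))"

end

theory Submission
  imports Defs
begin

text \<open>Each row is a Polya urn started with one ball of every colour, and the rows choose independently
  given the past. The visiting probabilities are bounded martingales whose \<open>t\<close>-th increment is at most
  \<open>1 / (t + 1)\<close>; orthogonality of the increments bounds the second moment of \<open>p i j t - p i j s\<close> by
  \<open>(t - s) / (s + 1)\<^sup>2\<close>. Hence the increments along the times \<open>k\<^sup>3\<close> are almost surely summable, and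
  between two consecutive cubes \<open>p i j\<close> moves by \<open>O(1/k)\<close> only, so \<open>p t\<close> converges without appeal to
  a martingale convergence theorem.

  The law of the limit is identified by its mixed moments. The product over the rows \<open>i\<close> of the ratios
  of rising factorials \<open>(\<Prod>j. pochhammer (w i j) (m i j)) / pochhammer (\<Sum>j. w i j) (\<Sum>j. m i j)\<close> has
  constant expectation and converges to the monomial with exponents \<open>m\<close> in the limit matrix; its
  initial value is the corresponding moment of independent flat Dirichlet vectors. On the unit cube,
  moments determine the law by one-dimensional Weierstrass approximation in each coordinate.\<close>

section \<open>Moments determine a law on the unit cube\<close>

text \<open>The Bernstein sums are rewritten as elements of \<open>real poly\<close>, because
  \<open>coeff\<close> and \<open>degree\<close> later turn expectations of polynomials into
  combinations of moments.\<close>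

lemma Weierstrass_poly:
  fixes f :: "real \<Rightarrow> real"
  assumes "continuous_on {0..1} f" "0 < e"
  shows "\<exists>q. \<forall>x\<in>{0..1}. \<bar>f x - poly q x\<bar> < e"
proof -
  obtain n where n: "\<And>x. x \<in> {0..1} \<Longrightarrow> \<bar>f x - (\<Sum>k\<le>n. f (k/n) * Bernstein n k x)\<bar> < e"
    using Bernstein_Weierstrass[OF assms] by blast
  define q where "q = (\<Sum>k\<le>n. smult (f (k/n) * of_nat (n choose k)) (monom 1 k * [:1, -1:] ^ (n - k)))"
  have "poly q x = (\<Sum>k\<le>n. f (k/n) * Bernstein n k x)" for x
    by (simp add: q_def poly_sum Bernstein_def poly_monom mult_ac)
  with n show ?thesis by (intro exI[of _ q]) auto
qed

text \<open>The indicator is a pointwise limit of continuous ramps, and each ramp is within 1/(N+1)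
  of a polynomial on the unit interval. The uniform bound 2 is what dominated convergence asks
  for.\<close>

lemma polys_tendsto_indicator_atMost:
  fixes a :: real
  obtains q :: "nat \<Rightarrow> real poly"
  where "\<And>x. x \<in> {0..1} \<Longrightarrow> (\<lambda>N. poly (q N) x) \<longlonglongrightarrow> indicator {..a} x"
    and "\<And>N x. x \<in> {0..1} \<Longrightarrow> \<bar>poly (q N) x\<bar> \<le> 2"
proof -
  \<comment> \<open>For N > 0 this is 1 up to a, falls with slope -N, and is 0 from a + 1/N on. The
    descent starts at a itself, so the limit at a is 1, as the closed half-line requires.\<close>
  define h where "h N x = max 0 (min 1 (1 - real N * (x - a)))" for N x
  have "\<exists>q. \<forall>x\<in>{0..1}. \<bar>h N x - poly q x\<bar> < 1 / real (Suc N)" for N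
    by (rule Weierstrass_poly) (auto simp: h_def intro!: continuous_intros)
  then obtain q where q: "\<And>N x. x \<in> {0..1} \<Longrightarrow> \<bar>h N x - poly (q N) x\<bar> < 1 / real (Suc N)"
    by metis
  have h: "(\<lambda>N. h N x) \<longlonglongrightarrow> indicator {..a} x" for x
  proof (cases "x \<le> a")
    case True
    then have "h N x = 1" for N by (auto simp: h_def mult_nonneg_nonpos)
    with True show ?thesis by simp
  next
    case False
    then obtain N0 where "1 < real N0 * (x - a)"
      using ex_less_of_nat_mult[of "x - a" 1] by auto
    then have "h N x = 0" if "N \<ge> N0" for N
      using mult_right_mono[of "real N0" "real N" "x - a"] that False \<open>1 < real N0 * (x - a)\<close>
      unfolding h_def by (intro max_absorb1) linarith
    then have "eventually (\<lambda>N. h N x = 0) sequentially"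
      by (auto simp: eventually_sequentially)
    with False show ?thesis by (auto intro: tendsto_eventually)
  qed
  show ?thesis
  proof
    fix x :: real assume x: "x \<in> {0..1}"
    have "(\<lambda>N. h N x - poly (q N) x) \<longlonglongrightarrow> 0"
      by (rule Lim_null_comparison[OF _ LIMSEQ_inverse_real_of_nat])
        (use q[OF x] in \<open>auto intro!: eventuallyI less_imp_le simp: inverse_eq_divide\<close>)
    from tendsto_diff[OF h[of x] this] show "(\<lambda>N. poly (q N) x) \<longlonglongrightarrow> indicator {..a} x" by simp
  next
    fix N and x :: real assume x: "x \<in> {0..1}"
    have "0 \<le> h N x" "h N x \<le> 1" by (auto simp: h_def)
    moreover have "1 / real (Suc N) \<le> 1" by simp
    ultimately show "\<bar>poly (q N) x\<bar> \<le> 2" using q[OF x, of N] by linarith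
  qed
qed

lemma (in prob_space) integrable_bounded:
  fixes f :: "'a \<Rightarrow> real"
  assumes "f \<in> borel_measurable M" "AE x in M. \<bar>f x\<bar> \<le> B"
  shows "integrable M f"
  using assms by (intro integrable_const_bound[of _ B]) auto

context prob_space
begin

context
  fixes X :: "'b \<Rightarrow> 'a \<Rightarrow> real" and K :: "'b set"
  assumes K: "finite K"
    and X[measurable]: "\<And>k. k \<in> K \<Longrightarrow> X k \<in> borel_measurable M"
    and unit: "\<And>k. k \<in> K \<Longrightarrow> AE \<omega> in M. X k \<omega> \<in> {0..1}"
begin

lemma integrable_prod_powers: "integrable M (\<lambda>\<omega>. \<Prod>k\<in>K. X k \<omega> ^ m k)"
proof (rule integrable_bounded[of _ 1])
  have "AE \<omega> in M. \<forall>k\<in>K. X k \<omega> \<in> {0..1}" using K unit by (simp add: AE_finite_all)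
  then show "AE \<omega> in M. \<bar>\<Prod>k\<in>K. X k \<omega> ^ m k\<bar> \<le> 1"
    by eventually_elim (auto simp: abs_prod intro!: prod_le_1 power_le_one)
qed measurable

text \<open>Distributing the product over the monomials leaves a finite combination of mixed
  moments, so two families with equal moments give the same value.\<close>

lemma expectation_prod_poly:
  "expectation (\<lambda>\<omega>. \<Prod>k\<in>K. poly (q k) (X k \<omega>)) =
    (\<Sum>m\<in>PiE K (\<lambda>k. {..degree (q k)}).
       (\<Prod>k\<in>K. coeff (q k) (m k)) * expectation (\<lambda>\<omega>. \<Prod>k\<in>K. X k \<omega> ^ m k))"
proof -
  have "(\<Prod>k\<in>K. poly (q k) (X k \<omega>)) = (\<Sum>m\<in>PiE K (\<lambda>k. {..degree (q k)}).
      (\<Prod>k\<in>K. coeff (q k) (m k)) * (\<Prod>k\<in>K. X k \<omega> ^ m k))" for \<omega>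
    unfolding poly_altdef using K by (subst prod_sum_PiE) (auto simp: prod.distrib)
  then show ?thesis by (simp add: integrable_prod_powers)
qed

text \<open>Dominated convergence: almost surely each of the \<open>card K\<close> factors is at
  most 2 in absolute value, and the limiting product of indicators is the indicator of the box
  event.\<close>

lemma expectation_prod_poly_tendsto_cdf:
  assumes "\<And>k x. k \<in> K \<Longrightarrow> x \<in> {0..1} \<Longrightarrow> (\<lambda>N. poly (q k N) x) \<longlonglongrightarrow> indicator {..a k} x"
    and "\<And>k N x. k \<in> K \<Longrightarrow> x \<in> {0..1} \<Longrightarrow> \<bar>poly (q k N) x\<bar> \<le> 2"
  shows "(\<lambda>N. expectation (\<lambda>\<omega>. \<Prod>k\<in>K. poly (q k N) (X k \<omega>)))
    \<longlonglongrightarrow> prob {\<omega> \<in> space M. \<forall>k\<in>K. X k \<omega> \<le> a k}"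
proof -
  have ae: "AE \<omega> in M. \<forall>k\<in>K. X k \<omega> \<in> {0..1}" using K unit by (simp add: AE_finite_all)
  have [measurable]: "(\<lambda>\<omega>. poly p (X k \<omega>)) \<in> borel_measurable M" if "k \<in> K" for p k
    unfolding poly_altdef using that by measurable
  let ?S = "{\<omega> \<in> space M. \<forall>k\<in>K. X k \<omega> \<le> a k}"
  have ind: "(\<Prod>k\<in>K. indicator {..a k} (X k \<omega>)) = (indicator ?S \<omega> :: real)" if "\<omega> \<in> space M" for \<omega>
    using that K by (auto simp: indicator_def intro: prod.neutral)
  have [measurable]: "?S \<in> sets M" using K by measurable
  have "(\<lambda>N. expectation (\<lambda>\<omega>. \<Prod>k\<in>K. poly (q k N) (X k \<omega>))) \<longlonglongrightarrow> expectation (indicator ?S)"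
  proof (rule integral_dominated_convergence[where w = "\<lambda>_. 2 ^ card K"])
    show "AE \<omega> in M. (\<lambda>N. \<Prod>k\<in>K. poly (q k N) (X k \<omega>)) \<longlonglongrightarrow> indicator ?S \<omega>"
      using ae AE_space
    proof eventually_elim
      case (elim \<omega>)
      then have "(\<lambda>N. \<Prod>k\<in>K. poly (q k N) (X k \<omega>)) \<longlonglongrightarrow> (\<Prod>k\<in>K. indicator {..a k} (X k \<omega>))"
        by (intro tendsto_prod assms) auto
      then show ?case using ind elim by simp
    qed
    show "AE \<omega> in M. norm (\<Prod>k\<in>K. poly (q k N) (X k \<omega>)) \<le> 2 ^ card K" for N
      using ae
    proof eventually_elim
      case (elim \<omega>)
      then have "(\<Prod>k\<in>K. \<bar>poly (q k N) (X k \<omega>)\<bar>) \<le> (\<Prod>k\<in>K. 2)"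
        by (intro prod_mono) (auto intro!: assms)
      then show ?case by (simp add: abs_prod)
    qed
  qed auto
  then show ?thesis by simp
qed

end

end

text \<open>The lower boxes \<open>B a\<close> are closed under intersection and generate the
  product sigma-algebra, so a law is determined by its joint distribution function.\<close>

lemma distr_eq_PiM_borel_cdf:
  fixes X :: "'b \<Rightarrow> 'a \<Rightarrow> real" and Y :: "'b \<Rightarrow> 'c \<Rightarrow> real"
  assumes "prob_space M" "prob_space N" and K: "finite K"
    and [measurable]: "\<And>k. k \<in> K \<Longrightarrow> X k \<in> borel_measurable M" "\<And>k. k \<in> K \<Longrightarrow> Y k \<in> borel_measurable N"
    and eq: "\<And>a. measure M {\<omega> \<in> space M. \<forall>k\<in>K. X k \<omega> \<le> a k} = measure N {\<omega> \<in> space N. \<forall>k\<in>K. Y k \<omega> \<le> a k}"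
  shows "distr M (PiM K (\<lambda>_. borel)) (\<lambda>\<omega>. \<lambda>k\<in>K. X k \<omega>) = distr N (PiM K (\<lambda>_. borel)) (\<lambda>\<omega>. \<lambda>k\<in>K. Y k \<omega>)"
    (is "?P = ?Q")
proof -
  interpret M: prob_space M by fact
  interpret N: prob_space N by fact
  define B where "B a = PiE K (\<lambda>k. {..a k :: real})" for a
  let ?\<Omega> = "PiE K (\<lambda>_. UNIV :: real set)"
  have "sets (PiM K (\<lambda>_. borel :: real measure)) = sets (PiM K (\<lambda>_. sigma UNIV (range (\<lambda>a::real. {..a}))))"
    by (simp only: borel_eq_atMost[symmetric])
  also have "\<dots> = sets (sigma ?\<Omega>
      {{f\<in>?\<Omega>. \<forall>i\<in>j. f i \<in> A i} | A j. j \<in> {K} \<and> A \<in> Pi j (\<lambda>_. range (\<lambda>a::real. {..a}))})"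
  \<comment> \<open>The finite index set is covered by the single block K, so a generator constrains
    all coordinates at once and is a full box.\<close>
  proof (rule sets_PiM_sigma)
    show "\<exists>S\<subseteq>range (\<lambda>a::real. {..a}). countable S \<and> UNIV = \<Union> S"
      by (rule exI[of _ "range (\<lambda>n. {..real n})"]) (auto intro: real_arch_simple)
  qed (use K in auto)
  also have "{{f\<in>?\<Omega>. \<forall>i\<in>j. f i \<in> A i} | A j. j \<in> {K} \<and> A \<in> Pi j (\<lambda>_. range (\<lambda>a::real. {..a}))} = range B"
  proof (intro equalityI subsetI)
    fix S assume "S \<in> {{f\<in>?\<Omega>. \<forall>i\<in>j. f i \<in> A i} | A j. j \<in> {K} \<and> A \<in> Pi j (\<lambda>_. range (\<lambda>a::real. {..a}))}"
    then obtain A where S: "S = {f\<in>?\<Omega>. \<forall>i\<in>K. f i \<in> A i}" and "\<forall>k\<in>K. \<exists>a. A k = {..a::real}"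
      by (auto simp: Pi_iff image_iff)
    then obtain a where "\<forall>k\<in>K. A k = {..a k}" by metis
    with S have "S = B a" by (auto simp: B_def PiE_iff extensional_def)
    then show "S \<in> range B" by blast
  next
    fix S assume "S \<in> range B"
    then obtain a where "S = B a" by blast
    then have "S = {f\<in>?\<Omega>. \<forall>i\<in>K. f i \<in> {..a i}}" by (auto simp: B_def PiE_iff extensional_def)
    then show "S \<in> {{f\<in>?\<Omega>. \<forall>i\<in>j. f i \<in> A i} | A j. j \<in> {K} \<and> A \<in> Pi j (\<lambda>_. range (\<lambda>a::real. {..a}))}"
      by (intro CollectI exI[of _ "\<lambda>i. {..a i}"] exI[of _ K]) auto
  qed
  finally have sets: "sets (PiM K (\<lambda>_. borel)) = sigma_sets ?\<Omega> (range B)"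
    by (simp add: B_def subset_eq PiE_iff)
  show ?thesis
  proof (rule measure_eqI_generator_eq[where E = "range B" and \<Omega> = ?\<Omega> and A = "\<lambda>n. B (\<lambda>_. real n)"])
    have "B a \<inter> B b = B (\<lambda>k. min (a k) (b k))" for a b
      by (auto simp: B_def PiE_iff)
    then show "Int_stable (range B)"
      by (auto simp: Int_stable_def)
    show "range B \<subseteq> Pow ?\<Omega>" by (auto simp: B_def PiE_iff)
    show "sets ?P = sigma_sets ?\<Omega> (range B)" "sets ?Q = sigma_sets ?\<Omega> (range B)" using sets by simp_all
    show "range (\<lambda>n. B (\<lambda>_. real n)) \<subseteq> range B" by auto
    show "(\<Union>n. B (\<lambda>_. real n)) = ?\<Omega>"
    proof (intro equalityI subsetI)
      fix x :: "'b \<Rightarrow> real" assume x: "x \<in> ?\<Omega>"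
      \<comment> \<open>The sum of the absolute values is one bound for all coordinates, so some box
        of the exhausting sequence contains x.\<close>
      obtain n where n: "(\<Sum>k\<in>K. \<bar>x k\<bar>) \<le> real n" using real_arch_simple by blast
      have "x k \<le> real n" if "k \<in> K" for k
        using member_le_sum[OF that, of "\<lambda>k. \<bar>x k\<bar>"] K n by simp
      with x show "x \<in> (\<Union>n. B (\<lambda>_. real n))" by (auto simp: B_def PiE_iff)
    qed (auto simp: B_def PiE_iff)
    have [measurable]: "B a \<in> sets (PiM K (\<lambda>_. borel))" for a
      unfolding B_def by (intro sets_PiM_I_finite K) auto
    have P: "emeasure ?P (B a) = emeasure M {\<omega> \<in> space M. \<forall>k\<in>K. X k \<omega> \<le> a k}" for a
    proof -
      have "(\<lambda>\<omega>. \<lambda>k\<in>K. X k \<omega>) -` B a \<inter> space M = {\<omega> \<in> space M. \<forall>k\<in>K. X k \<omega> \<le> a k}"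
        by (auto simp: B_def PiE_iff)
      then show ?thesis by (simp add: emeasure_distr)
    qed
    have Q: "emeasure ?Q (B a) = emeasure N {\<omega> \<in> space N. \<forall>k\<in>K. Y k \<omega> \<le> a k}" for a
    proof -
      have "(\<lambda>\<omega>. \<lambda>k\<in>K. Y k \<omega>) -` B a \<inter> space N = {\<omega> \<in> space N. \<forall>k\<in>K. Y k \<omega> \<le> a k}"
        by (auto simp: B_def PiE_iff)
      then show ?thesis by (simp add: emeasure_distr)
    qed
    show "emeasure ?P (B (\<lambda>_. real n)) \<noteq> \<infinity>" for n
      unfolding P by (simp add: M.emeasure_eq_measure)
    fix A assume "A \<in> range B"
    then show "emeasure ?P A = emeasure ?Q A"
      using eq P Q by (auto simp: M.emeasure_eq_measure N.emeasure_eq_measure)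
  qed
qed

text \<open>For each box, the same polynomials approximate both distribution functions. Their
  expectations agree at every stage by equality of moments, hence so do the limits.\<close>

lemma distr_eq_PiM_borel_moments:
  fixes X :: "'b \<Rightarrow> 'a \<Rightarrow> real" and Y :: "'b \<Rightarrow> 'c \<Rightarrow> real"
  assumes M: "prob_space M" and N: "prob_space N" and K: "finite K"
    and X: "\<And>k. k \<in> K \<Longrightarrow> X k \<in> borel_measurable M" "\<And>k. k \<in> K \<Longrightarrow> AE \<omega> in M. X k \<omega> \<in> {0..1}"
    and Y: "\<And>k. k \<in> K \<Longrightarrow> Y k \<in> borel_measurable N" "\<And>k. k \<in> K \<Longrightarrow> AE \<omega> in N. Y k \<omega> \<in> {0..1}"
    and eq: "\<And>m. (\<integral>\<omega>. (\<Prod>k\<in>K. X k \<omega> ^ m k) \<partial>M) = (\<integral>\<omega>. (\<Prod>k\<in>K. Y k \<omega> ^ m k) \<partial>N)"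
  shows "distr M (PiM K (\<lambda>_. borel)) (\<lambda>\<omega>. \<lambda>k\<in>K. X k \<omega>) = distr N (PiM K (\<lambda>_. borel)) (\<lambda>\<omega>. \<lambda>k\<in>K. Y k \<omega>)"
proof (rule distr_eq_PiM_borel_cdf[OF M N K X(1) Y(1)])
  fix a :: "'b \<Rightarrow> real"
  have "\<exists>q :: nat \<Rightarrow> real poly. (\<forall>x\<in>{0..1}. (\<lambda>N. poly (q N) x) \<longlonglongrightarrow> indicator {..a k} x)
      \<and> (\<forall>N. \<forall>x\<in>{0..1}. \<bar>poly (q N) x\<bar> \<le> 2)" for k
    by (rule polys_tendsto_indicator_atMost[of "a k"]) blast
  then obtain q :: "'b \<Rightarrow> nat \<Rightarrow> real poly"
    where q: "\<And>k x. x \<in> {0..1} \<Longrightarrow> (\<lambda>N. poly (q k N) x) \<longlonglongrightarrow> indicator {..a k} x"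
      "\<And>k N x. x \<in> {0..1} \<Longrightarrow> \<bar>poly (q k N) x\<bar> \<le> 2" by metis
  show "measure M {\<omega> \<in> space M. \<forall>k\<in>K. X k \<omega> \<le> a k} = measure N {\<omega> \<in> space N. \<forall>k\<in>K. Y k \<omega> \<le> a k}"
  proof (rule LIMSEQ_unique)
    show "(\<lambda>N. \<integral>\<omega>. (\<Prod>k\<in>K. poly (q k N) (X k \<omega>)) \<partial>M) \<longlonglongrightarrow> measure M {\<omega> \<in> space M. \<forall>k\<in>K. X k \<omega> \<le> a k}"
      by (rule prob_space.expectation_prod_poly_tendsto_cdf[OF M K X q]) auto
    have "(\<lambda>n. \<integral>\<omega>. (\<Prod>k\<in>K. poly (q k n) (Y k \<omega>)) \<partial>N) \<longlonglongrightarrow> measure N {\<omega> \<in> space N. \<forall>k\<in>K. Y k \<omega> \<le> a k}"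
      by (rule prob_space.expectation_prod_poly_tendsto_cdf[OF N K Y q]) auto
    then show "(\<lambda>N. \<integral>\<omega>. (\<Prod>k\<in>K. poly (q k N) (X k \<omega>)) \<partial>M) \<longlonglongrightarrow> measure N {\<omega> \<in> space N. \<forall>k\<in>K. Y k \<omega> \<le> a k}"
      by (simp add: prob_space.expectation_prod_poly[OF M K X] prob_space.expectation_prod_poly[OF N K Y] eq)
  qed
qed

section \<open>Moments of the flat Dirichlet distribution\<close>

text \<open>A Beta integral rescaled from the unit interval to (0, u). Extending the integrand by
  zero keeps the integral over the whole line, which is the form met when a coordinate of the
  simplex is integrated out.\<close>

lemma nn_integral_power_times_power:
  fixes u :: real
  shows "(\<integral>\<^sup>+y. ennreal (if 0 < y \<and> y < u then y ^ a * (u - y) ^ b else 0) \<partial>lborel)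
    = ennreal (if 0 < u then u ^ Suc (a + b) * (fact a * fact b / fact (Suc (a + b))) else 0)"
proof (cases "0 < u")
  case False
  then have "(if 0 < y \<and> y < u then y ^ a * (u - y) ^ b else 0) = 0" for y by auto
  with False show ?thesis by simp
next
  case True
  have "((\<lambda>t. t powr real a * (1 - t) powr real b) has_integral Beta (real (Suc a)) (real (Suc b))) {0<..<1}"
    using has_integral_Beta_real[of "real (Suc a)" "real (Suc b)"] by (simp add: has_integral_Icc_iff_Ioo)
  then have "((\<lambda>t. t ^ a * (1 - t) ^ b) has_integral Beta (real (Suc a)) (real (Suc b))) {0<..<1::real}"
    \<comment> \<open>On the open interval both bases are positive, so \<open>powr\<close> agrees
      with the natural power even for exponent 0.\<close>
    by (rule has_integral_eq[rotated]) (simp add: powr_realpow)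
  also have "Beta (real (Suc a)) (real (Suc b)) = fact a * fact b / fact (Suc (a + b))"
    using Gamma_fact[of a, where 'a = real] Gamma_fact[of b, where 'a = real]
      Gamma_fact[of "Suc (a + b)", where 'a = real]
    by (simp add: Beta_def add_ac)
  finally have I: "(\<integral>\<^sup>+t. indicator {0<..<1} t * ennreal (t ^ a * (1 - t) ^ b) \<partial>lborel)
      = ennreal (fact a * fact b / fact (Suc (a + b)))"
    using nn_integral_has_integral_lebesgue[of "{0<..<1::real}" "\<lambda>t. t ^ a * (1 - t) ^ b"] by (simp add: ennreal_indicator[symmetric] ennreal_mult')
  have "(\<integral>\<^sup>+y. ennreal (if 0 < y \<and> y < u then y ^ a * (u - y) ^ b else 0) \<partial>lborel)
      = ennreal u * (\<integral>\<^sup>+t. ennreal (if 0 < u * t \<and> u * t < u then (u * t) ^ a * (u - u * t) ^ b else 0) \<partial>lborel)"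
    \<comment> \<open>The substitution y = u * t; its Jacobian u supplies the extra power of u in
      the result.\<close>
    using True by (subst nn_integral_real_affine[of _ u 0]) (auto cong: if_cong)
  also have "\<dots> = ennreal u * (\<integral>\<^sup>+t. ennreal (u ^ (a + b)) * (indicator {0<..<1} t * ennreal (t ^ a * (1 - t) ^ b)) \<partial>lborel)"
  proof (intro arg_cong2[where f = "(*)"] refl nn_integral_cong)
    fix t :: real
    have "u * t < u \<longleftrightarrow> t < 1" "0 < u * t \<longleftrightarrow> 0 < t" "u - u * t = u * (1 - t)"
      using True by (auto simp: zero_less_mult_iff algebra_simps)
    then show "ennreal (if 0 < u * t \<and> u * t < u then (u * t) ^ a * (u - u * t) ^ b else 0)
        = ennreal (u ^ (a + b)) * (indicator {0<..<1} t * ennreal (t ^ a * (1 - t) ^ b))"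
      using True by (auto simp: power_mult_distrib power_add ennreal_mult'[symmetric] indicator_def mult_ac)
  qed
  also have "\<dots> = ennreal u * (ennreal (u ^ (a + b)) * ennreal (fact a * fact b / fact (Suc (a + b))))"
    by (subst nn_integral_cmult) (auto simp: I)
  finally show ?thesis
    using True by (simp add: ennreal_mult'[symmetric] mult_ac del: fact_Suc)
qed

text \<open>Dirichlet's integral, by induction on J. Integrating out one coordinate is a Beta
  integral in the mass left over by the others; it raises the exponent of that mass from b to m i +
  b + 1, hence the generalisation over b.\<close>

lemma nn_integral_simplex_monomial:
  fixes m :: "'i \<Rightarrow> nat"
  assumes "finite J"
  shows "(\<integral>\<^sup>+x. ennreal (if (\<forall>j\<in>J. 0 < x j) \<and> 0 < 1 - (\<Sum>j\<in>J. x j)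
        then (\<Prod>j\<in>J. x j ^ m j) * (1 - (\<Sum>j\<in>J. x j)) ^ b else 0) \<partial>Pi\<^sub>M J (\<lambda>_. lborel))
      = ennreal ((\<Prod>j\<in>J. fact (m j)) * fact b / fact ((\<Sum>j\<in>J. m j) + b + card J))"
  using assms
proof (induction J arbitrary: b)
  case empty
  then show ?case by (simp add: PiM_empty)
next
  case (insert i J)
  interpret product_sigma_finite "\<lambda>_::'i. lborel :: real measure" ..
  note [simp] = insert.hyps
  \<comment> \<open>The value of the inner Beta integral over (0, 1).\<close>
  define c where "c = (fact (m i) * fact b / fact (Suc (m i + b)) :: real)"
  have "c \<ge> 0" by (simp add: c_def)
  define G where "G x = (if \<forall>j\<in>J. 0 < x j then \<Prod>j\<in>J. x j ^ m j else 0)" for x :: "'i \<Rightarrow> real"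
  have G: "G x \<ge> 0" for x 
    unfolding G_def by (split if_split) (intro conjI impI prod_nonneg zero_le_power order_refl, auto intro: less_imp_le)
  \<comment> \<open>The mass left for coordinate i and the implicit last coordinate once those in J
    are fixed.\<close>
  define u where "u x = 1 - (\<Sum>j\<in>J. x j)" for x :: "'i \<Rightarrow> real"
  let ?F = "\<lambda>y x. if 0 < y \<and> y < u x then y ^ m i * (u x - y) ^ b else 0"
  have upd: "(if (\<forall>j\<in>insert i J. 0 < (x(i := y)) j) \<and> 0 < 1 - (\<Sum>j\<in>insert i J. (x(i := y)) j)
      then (\<Prod>j\<in>insert i J. (x(i := y)) j ^ m j) * (1 - (\<Sum>j\<in>insert i J. (x(i := y)) j)) ^ b else 0)
      = G x * ?F y x" for x :: "'i \<Rightarrow> real" and y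
  proof -
    have "(x(i := y)) j = x j" if "j \<in> J" for j using that by auto
    then have "(\<Sum>j\<in>insert i J. (x(i := y)) j) = y + (\<Sum>j\<in>J. x j)"
      "(\<Prod>j\<in>insert i J. (x(i := y)) j ^ m j) = y ^ m i * (\<Prod>j\<in>J. x j ^ m j)"
      "(\<forall>j\<in>insert i J. 0 < (x(i := y)) j) \<longleftrightarrow> 0 < y \<and> (\<forall>j\<in>J. 0 < x j)"
      by auto
    then show ?thesis by (auto simp: G_def u_def algebra_simps)
  qed
  have "(\<integral>\<^sup>+x. ennreal (if (\<forall>j\<in>insert i J. 0 < x j) \<and> 0 < 1 - (\<Sum>j\<in>insert i J. x j)
        then (\<Prod>j\<in>insert i J. x j ^ m j) * (1 - (\<Sum>j\<in>insert i J. x j)) ^ b else 0) \<partial>Pi\<^sub>M (insert i J) (\<lambda>_. lborel))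
      = (\<integral>\<^sup>+x. (\<integral>\<^sup>+y. ennreal (G x * ?F y x) \<partial>lborel) \<partial>Pi\<^sub>M J (\<lambda>_. lborel))"
    by (subst product_nn_integral_insert) (simp_all only: upd insert.hyps, measurable)
  also have "\<dots> = (\<integral>\<^sup>+x. ennreal c * ennreal (if (\<forall>j\<in>J. 0 < x j) \<and> 0 < 1 - (\<Sum>j\<in>J. x j)
        then (\<Prod>j\<in>J. x j ^ m j) * (1 - (\<Sum>j\<in>J. x j)) ^ Suc (m i + b) else 0) \<partial>Pi\<^sub>M J (\<lambda>_. lborel))"
  proof (intro nn_integral_cong)
    fix x :: "'i \<Rightarrow> real"
    have "(\<integral>\<^sup>+y. ennreal (G x * ?F y x) \<partial>lborel) = ennreal (G x) * (\<integral>\<^sup>+y. ennreal (?F y x) \<partial>lborel)"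
      using G by (subst nn_integral_cmult[symmetric]) (auto simp: ennreal_mult')
    also have "\<dots> = ennreal (G x * (if 0 < u x then u x ^ Suc (m i + b) * c else 0))"
      using G by (simp add: nn_integral_power_times_power c_def ennreal_mult' del: fact_Suc)
    also have "G x * (if 0 < u x then u x ^ Suc (m i + b) * c else 0) = c * (if (\<forall>j\<in>J. 0 < x j) \<and> 0 < 1 - (\<Sum>j\<in>J. x j)
        then (\<Prod>j\<in>J. x j ^ m j) * (1 - (\<Sum>j\<in>J. x j)) ^ Suc (m i + b) else 0)"
      by (auto simp: G_def u_def)
    finally show "(\<integral>\<^sup>+y. ennreal (G x * ?F y x) \<partial>lborel) = ennreal c * ennreal (if (\<forall>j\<in>J. 0 < x j) \<and> 0 < 1 - (\<Sum>j\<in>J. x j)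
        then (\<Prod>j\<in>J. x j ^ m j) * (1 - (\<Sum>j\<in>J. x j)) ^ Suc (m i + b) else 0)"
      using \<open>c \<ge> 0\<close> by (simp add: ennreal_mult')
  qed
  also have "\<dots> = ennreal c * ennreal ((\<Prod>j\<in>J. fact (m j)) * fact (Suc (m i + b)) / fact ((\<Sum>j\<in>J. m j) + Suc (m i + b) + card J))"
    by (subst nn_integral_cmult) (measurable, simp only: insert.IH)
  also have "\<dots> = ennreal ((\<Prod>j\<in>insert i J. fact (m j)) * fact b / fact ((\<Sum>j\<in>insert i J. m j) + b + card (insert i J)))"
    using \<open>c \<ge> 0\<close> by (subst ennreal_mult'[symmetric]) (auto simp: c_def field_simps simp del: fact_Suc)
  finally show ?case .
qed

text \<open>All exponents vanish and the normalising constant is Gamma k = (k - 1)!, so the law is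
  uniform on the open simplex.\<close>

lemma dirichlet_density_ones:
  assumes "1 \<le> k"
  shows "dirichlet_density k (\<lambda>_. 1) y = (if \<forall>j\<in>{1..k}. 0 < y j then fact (k - 1) else 0)"
  using assms Gamma_fact[of "k - 1", where 'a = real]
  by (auto simp: dirichlet_density_def of_nat_diff intro!: prod.neutral)

lemma measurable_add_last[measurable]:
  assumes "1 \<le> k"
  shows "add_last k \<in> Pi\<^sub>M {1..<k} (\<lambda>_. borel) \<rightarrow>\<^sub>M Pi\<^sub>M {1..k} (\<lambda>_. borel)"
proof -
  have k: "{1..k} = insert k {1..<k}" using assms by auto
  show ?thesis unfolding add_last_def[abs_def] k by measurable
qed

lemma measurable_dirichlet_density[measurable]:
  "dirichlet_density k \<alpha> \<in> borel_measurable (Pi\<^sub>M {1..k} (\<lambda>_. borel))"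
  unfolding dirichlet_density_def[abs_def] by measurable

lemma measurable_add_last_lborel[measurable]:
  assumes "1 \<le> k"
  shows "add_last k \<in> Pi\<^sub>M {1..<k} (\<lambda>_. lborel) \<rightarrow>\<^sub>M Pi\<^sub>M {1..k} (\<lambda>_. borel)"
  using measurable_add_last[OF assms] by (subst measurable_cong_sets[OF sets_PiM_cong refl]) auto

context
  fixes k :: nat
  assumes k: "1 \<le> k"
begin

lemma AE_dirichlet_ones_pos: "AE x in dirichlet k (\<lambda>_. 1). \<forall>j\<in>{1..k}. 0 < x j"
  unfolding dirichlet_def using k
  by (subst AE_distr_iff)
      (auto simp: AE_density dirichlet_density_ones simp del: One_nat_def intro!: measurable_add_last_lborel)

text \<open>The last coordinate is 1 minus the sum of the others, so its power is the factor with
  exponent b = m k in \<open>nn_integral_simplex_monomial\<close>, applied to the remaining k - 1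
  coordinates.\<close>

lemma nn_integral_dirichlet_ones_monomial:
  "(\<integral>\<^sup>+x. ennreal (\<Prod>j\<in>{1..k}. x j ^ m j) \<partial>dirichlet k (\<lambda>_. 1))
    = ennreal (fact (k - 1) * (\<Prod>j\<in>{1..k}. fact (m j)) / fact ((\<Sum>j\<in>{1..k}. m j) + k - 1))"
proof -
  have K: "{1..k} = insert k {1..<k}" using k by auto
  note [measurable] = measurable_add_last_lborel[OF k]
  have [measurable]: "(\<lambda>x. dirichlet_density k (\<lambda>_. 1) (add_last k x)) \<in> borel_measurable (Pi\<^sub>M {1..<k} (\<lambda>_. lborel))"
    by measurable
  have "(\<integral>\<^sup>+x. ennreal (\<Prod>j\<in>{1..k}. x j ^ m j) \<partial>dirichlet k (\<lambda>_. 1))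
      = (\<integral>\<^sup>+x. ennreal (\<Prod>j\<in>{1..k}. add_last k x j ^ m j)
          \<partial>density (Pi\<^sub>M {1..<k} (\<lambda>_. lborel)) (\<lambda>x. ennreal (dirichlet_density k (\<lambda>_. 1) (add_last k x))))"
    unfolding dirichlet_def by (subst nn_integral_distr) (auto simp del: One_nat_def)
  also have "\<dots> = (\<integral>\<^sup>+x. ennreal (dirichlet_density k (\<lambda>_. 1) (add_last k x)) * ennreal (\<Prod>j\<in>{1..k}. add_last k x j ^ m j)
          \<partial>Pi\<^sub>M {1..<k} (\<lambda>_. lborel))"
    by (rule nn_integral_density) measurable
  also have "\<dots> = (\<integral>\<^sup>+x. ennreal (fact (k - 1)) * ennreal (if (\<forall>j\<in>{1..<k}. 0 < x j) \<and> 0 < 1 - (\<Sum>j\<in>{1..<k}. x j)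
        then (\<Prod>j\<in>{1..<k}. x j ^ m j) * (1 - (\<Sum>j\<in>{1..<k}. x j)) ^ m k else 0) \<partial>Pi\<^sub>M {1..<k} (\<lambda>_. lborel))"
  proof (intro nn_integral_cong)
    fix x :: "nat \<Rightarrow> real"
    have "(\<Prod>j\<in>{1..k}. add_last k x j ^ m j) = (\<Prod>j\<in>{1..<k}. x j ^ m j) * (1 - (\<Sum>j\<in>{1..<k}. x j)) ^ m k"
      unfolding K by (subst prod.insert) (auto simp: add_last_def intro!: prod.cong)
    moreover have "(\<forall>j\<in>{1..k}. 0 < add_last k x j) \<longleftrightarrow> (\<forall>j\<in>{1..<k}. 0 < x j) \<and> 0 < 1 - (\<Sum>j\<in>{1..<k}. x j)"
      unfolding K by (auto simp: add_last_def)
    ultimately show "ennreal (dirichlet_density k (\<lambda>_. 1) (add_last k x)) * ennreal (\<Prod>j\<in>{1..k}. add_last k x j ^ m j)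
      = ennreal (fact (k - 1)) * ennreal (if (\<forall>j\<in>{1..<k}. 0 < x j) \<and> 0 < 1 - (\<Sum>j\<in>{1..<k}. x j)
        then (\<Prod>j\<in>{1..<k}. x j ^ m j) * (1 - (\<Sum>j\<in>{1..<k}. x j)) ^ m k else 0)"
      using k by (simp only: dirichlet_density_ones) simp
  qed
  also have "\<dots> = ennreal (fact (k - 1)) * ennreal ((\<Prod>j\<in>{1..<k}. fact (m j)) * fact (m k) / fact ((\<Sum>j\<in>{1..<k}. m j) + m k + (k - 1)))"
    by (subst nn_integral_cmult) (measurable, subst nn_integral_simplex_monomial, simp_all)
  also have "\<dots> = ennreal (fact (k - 1) * (\<Prod>j\<in>{1..k}. fact (m j)) / fact ((\<Sum>j\<in>{1..k}. m j) + k - 1))"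
    unfolding K using k by (subst ennreal_mult'[symmetric]) (auto simp: mult_ac add_ac)
  finally show ?thesis .
qed

text \<open>The total mass is the moment with all exponents 0.\<close>

lemma prob_space_dirichlet_ones: "prob_space (dirichlet k (\<lambda>_. 1))"
  using nn_integral_dirichlet_ones_monomial[of "\<lambda>_. 0"] by (intro prob_spaceI) simp

lemma integral_dirichlet_ones_monomial:
  "(\<integral>x. (\<Prod>j\<in>{1..k}. x j ^ m j) \<partial>dirichlet k (\<lambda>_. 1))
    = fact (k - 1) * (\<Prod>j\<in>{1..k}. fact (m j)) / fact ((\<Sum>j\<in>{1..k}. m j) + k - 1)"
proof -
  have [measurable_cong]: "sets (dirichlet k (\<lambda>_. 1)) = sets (Pi\<^sub>M {1..k} (\<lambda>_. borel))"
    by (simp add: dirichlet_def)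
  have "AE x in dirichlet k (\<lambda>_. 1). 0 \<le> (\<Prod>j\<in>{1..k}. x j ^ m j)"
    using AE_dirichlet_ones_pos by eventually_elim (intro prod_nonneg zero_le_power, auto intro: less_imp_le)
  then show ?thesis
    by (subst integral_eq_nn_integral)
      (auto simp: nn_integral_dirichlet_ones_monomial prod_nonneg simp del: One_nat_def)
qed

text \<open>Where the density is nonzero the coordinates are positive, and they always sum to
  1.\<close>

lemma AE_dirichlet_ones_le_1: "AE x in dirichlet k (\<lambda>_. 1). \<forall>j\<in>{1..k}. x j \<le> 1"
proof -
  have K: "{1..k} = insert k {1..<k}" using k by auto
  have "add_last k x j \<le> 1" if "\<forall>j\<in>{1..k}. 0 < add_last k x j" "j \<in> {1..k}" for x j
  proof -
    have "(\<Sum>j\<in>{1..k}. add_last k x j) = 1"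
      unfolding K by (subst sum.insert) (auto simp: add_last_def intro!: sum.cong)
    moreover have "add_last k x j \<le> (\<Sum>j\<in>{1..k}. add_last k x j)"
      using that by (intro member_le_sum) (auto intro: less_imp_le)
    ultimately show ?thesis by simp
  qed
  then show ?thesis
    unfolding dirichlet_def using k
    by (subst AE_distr_iff)
      (auto simp: AE_density dirichlet_density_ones simp del: One_nat_def intro!: measurable_add_last_lborel)
qed

end

section \<open>Polya's urn\<close>

text \<open>For positive weights w this is the probability that an urn with weights w produces one
  prescribed sequence of draws containing colour j exactly m j times; it is also the moment with
  exponents m of the Dirichlet law with parameters w.\<close>

definition polya_ratio :: "'i set \<Rightarrow> ('i \<Rightarrow> nat) \<Rightarrow> ('i \<Rightarrow> real) \<Rightarrow> real" where
  "polya_ratio J m w = (\<Prod>j\<in>J. pochhammer (w j) (m j)) / pochhammer (\<Sum>j\<in>J. w j) (\<Sum>j\<in>J. m j)"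

text \<open>The martingale property of the urn. Adding a ball of colour l turns w l times the
  numerator into the old numerator times w l + m l; summed over l this gives S + M, which is exactly
  the factor by which the denominators differ.\<close>

lemma polya_ratio_step:
  assumes J: "finite J" and pos: "0 < (\<Sum>j\<in>J. w j)"
  shows "(\<Sum>l\<in>J. w l / (\<Sum>j\<in>J. w j) * polya_ratio J m (w(l := w l + 1))) = polya_ratio J m w"
proof -
  define S M where "S = (\<Sum>j\<in>J. w j)" and "M = (\<Sum>j\<in>J. m j)"
  have S: "S > 0" using pos by (simp add: S_def)
  have poch: "pochhammer (S + 1) M > 0" "pochhammer S M > 0" using S by (auto intro: pochhammer_pos)
  \<comment> \<open>Stated without division, so that it also covers colours of weight 0.\<close>
  have rec: "a * pochhammer (a + 1) k = pochhammer a k * (a + real k)" for a :: real and k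
    by (metis pochhammer_Suc pochhammer_rec)
  have summand: "w l / S * polya_ratio J m (w(l := w l + 1))
      = (\<Prod>j\<in>J. pochhammer (w j) (m j)) * (w l + real (m l)) / (S * pochhammer (S + 1) M)" if l: "l \<in> J" for l
  proof -
    have "(\<Sum>j\<in>J. (w(l := w l + 1)) j) = S + 1"
      using J l by (simp add: S_def sum.remove[of J l])
    moreover have "w l * (\<Prod>j\<in>J. pochhammer ((w(l := w l + 1)) j) (m j))
        = (\<Prod>j\<in>J. pochhammer (w j) (m j)) * (w l + real (m l))"
      using J l rec[of "w l" "m l"] by (simp add: prod.remove[of J l] mult_ac)
    ultimately show ?thesis by (simp add: polya_ratio_def M_def)
  qed
  have "(\<Sum>l\<in>J. w l / S * polya_ratio J m (w(l := w l + 1)))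
      = (\<Prod>j\<in>J. pochhammer (w j) (m j)) * (S + real M) / (S * pochhammer (S + 1) M)"
    using summand by (simp add: sum_divide_distrib[symmetric] sum_distrib_left[symmetric] sum.distrib S_def M_def)
  also have "\<dots> = (\<Prod>j\<in>J. pochhammer (w j) (m j)) / pochhammer S M"
    using rec[of S M] S poch by (simp add: frac_eq_eq)
  finally show ?thesis by (simp add: polya_ratio_def S_def M_def)
qed

text \<open>Numerator and denominator both have as many factors as the sum of the m j, so every
  factor can be divided by S. Bounds and limits are read off this form.\<close>

lemma polya_ratio_scaled:
  assumes J: "finite J" and S: "S = (\<Sum>j\<in>J. w j)" "S \<noteq> 0"
  shows "polya_ratio J m w = (\<Prod>j\<in>J. \<Prod>l<m j. (w j + real l) / S) / (\<Prod>l<(\<Sum>j\<in>J. m j). 1 + real l / S)"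
proof -
  have poch: "pochhammer a k = S ^ k * (\<Prod>l<k. (a + real l) / S)" for a k
    using S by (simp add: pochhammer_prod prod_dividef atLeast0LessThan)
  have "pochhammer S k = S ^ k * (\<Prod>l<k. 1 + real l / S)" for k
    unfolding poch[of S] using S by (simp add: add_divide_distrib)
  then show ?thesis
    unfolding polya_ratio_def S(1)[symmetric] poch[of "w _"] using S J
    by (simp add: prod.distrib power_sum)
qed

text \<open>In the scaled form (w j + l) / S is at most 1 + l, since w j is at most S and S is at
  least 1, while the denominator is at least 1. The bound is independent of the weights, hence
  uniform in time.\<close>

lemma polya_ratio_bounds:
  assumes J: "finite J" and w: "\<And>j. j \<in> J \<Longrightarrow> 0 \<le> w j" and S: "1 \<le> (\<Sum>j\<in>J. w j)"
  shows "0 \<le> polya_ratio J m w" "polya_ratio J m w \<le> (\<Prod>j\<in>J. fact (m j))"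
proof -
  define S where "S = (\<Sum>j\<in>J. w j)"
  have S1: "1 \<le> S" using S by (simp add: S_def)
  have le: "w j \<le> S" if "j \<in> J" for j
    unfolding S_def using J w that by (intro member_le_sum) auto
  have fact: "(\<Prod>l<k. 1 + real l) = fact k" for k
    by (simp add: fact_prod_Suc atLeast0LessThan)
  have num: "(\<Prod>j\<in>J. \<Prod>l<m j. (w j + real l) / S) \<le> (\<Prod>j\<in>J. fact (m j))"
  proof (intro prod_mono conjI)
    fix j assume j: "j \<in> J"
    show "0 \<le> (\<Prod>l<m j. (w j + real l) / S)"
      using w[OF j] S1 by (intro prod_nonneg) auto
    have "(\<Prod>l<m j. (w j + real l) / S) \<le> (\<Prod>l<m j. 1 + real l)"
    proof (intro prod_mono conjI)
      fix l
      show "0 \<le> (w j + real l) / S" using w[OF j] S1 by auto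
      have "real l \<le> real l * S" using mult_left_mono[OF S1, of "real l"] by simp
      then show "(w j + real l) / S \<le> 1 + real l"
        using le[OF j] S1 by (simp add: field_simps)
    qed
    then show "(\<Prod>l<m j. (w j + real l) / S) \<le> fact (m j)" by (simp add: fact)
  qed
  have num0: "0 \<le> (\<Prod>j\<in>J. \<Prod>l<m j. (w j + real l) / S)"
    using w S1 by (intro prod_nonneg) auto
  have den: "1 \<le> (\<Prod>l<(\<Sum>j\<in>J. m j). 1 + real l / S)"
    using S1 by (intro prod_ge_1) auto
  have eq: "polya_ratio J m w = (\<Prod>j\<in>J. \<Prod>l<m j. (w j + real l) / S) / (\<Prod>l<(\<Sum>j\<in>J. m j). 1 + real l / S)"
    using S1 by (intro polya_ratio_scaled J) (auto simp: S_def)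
  show "0 \<le> polya_ratio J m w" unfolding eq using num0 den by simp
  show "polya_ratio J m w \<le> (\<Prod>j\<in>J. fact (m j))"
    unfolding eq using divide_left_mono[OF den num0] den num by simp
qed

text \<open>In the scaled form the shifts l / S disappear in the limit, leaving m j factors p j for
  each j and a denominator tending to 1.\<close>

lemma tendsto_polya_ratio:
  assumes J: "finite J"
    and w: "\<And>j. j \<in> J \<Longrightarrow> (\<lambda>t. w t j / (\<Sum>j\<in>J. w t j)) \<longlonglongrightarrow> p j"
    and S: "filterlim (\<lambda>t. \<Sum>j\<in>J. w t j) at_top sequentially"
  shows "(\<lambda>t. polya_ratio J m (w t)) \<longlonglongrightarrow> (\<Prod>j\<in>J. p j ^ m j)"
proof -
  have l: "(\<lambda>t. real l / (\<Sum>j\<in>J. w t j)) \<longlonglongrightarrow> 0" for l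
    by (intro real_tendsto_divide_at_top[OF tendsto_const] S)
  have "(\<lambda>t. (\<Prod>j\<in>J. \<Prod>l<m j. w t j / (\<Sum>j\<in>J. w t j) + real l / (\<Sum>j\<in>J. w t j))
        / (\<Prod>l<(\<Sum>j\<in>J. m j). 1 + real l / (\<Sum>j\<in>J. w t j)))
      \<longlonglongrightarrow> (\<Prod>j\<in>J. \<Prod>l<m j. p j + 0) / (\<Prod>l<(\<Sum>j\<in>J. m j). 1 + 0)"
    by (intro tendsto_divide tendsto_prod tendsto_add w l tendsto_const) auto
  moreover have "eventually (\<lambda>t. (\<Prod>j\<in>J. \<Prod>l<m j. w t j / (\<Sum>j\<in>J. w t j) + real l / (\<Sum>j\<in>J. w t j))
        / (\<Prod>l<(\<Sum>j\<in>J. m j). 1 + real l / (\<Sum>j\<in>J. w t j)) = polya_ratio J m (w t)) sequentially"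
    \<comment> \<open>The total weight is eventually positive, so the scaled form is
      available.\<close>
    using filterlim_at_top_dense[THEN iffD1, rule_format, OF S, of 0]
    by eventually_elim (subst polya_ratio_scaled[OF J refl], auto simp: add_divide_distrib)
  ultimately show ?thesis by (auto dest: Lim_transform_eventually)
qed

section \<open>Almost sure convergence along cubes\<close>

text \<open>Telescoping gives convergence along the cubes. From k^3 to (k + 1)^3 there are O(k^2)
  steps of size at most 1 / (k^3 + 1), so the rest of the sequence stays within O(1/k) of the cubic
  subsequence.\<close>

lemma convergent_if_cubic_subsequence:
  fixes f :: "nat \<Rightarrow> real"
  assumes step: "\<And>t. \<bar>f (Suc t) - f t\<bar> \<le> 1 / real (Suc t)"
    and sub: "summable (\<lambda>k. \<bar>f (Suc k ^ 3) - f (k ^ 3)\<bar>)"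
  shows "convergent f"
proof -
  have "summable (\<lambda>k. f (Suc k ^ 3) - f (k ^ 3))" using sub by (rule summable_rabs_cancel)
  moreover have "(\<Sum>k<N. f (Suc k ^ 3) - f (k ^ 3)) = f (N ^ 3) - f 0" for N
    using sum_lessThan_telescope[of "\<lambda>k. f (k ^ 3)" N] by simp
  ultimately have "convergent (\<lambda>N. f (N ^ 3) - f 0)" by (simp add: summable_iff_convergent)
  then have "convergent (\<lambda>N. f (N ^ 3))" by (simp add: convergent_diff_const_right_iff)
  then obtain L where L: "(\<lambda>k. f (k ^ 3)) \<longlonglongrightarrow> L" by (auto simp: convergent_def)
  \<comment> \<open>The integer part of the cube root: the cube of c t is the last one not exceeding
    t.\<close>
  define c where "c t = nat \<lfloor>root 3 (real t)\<rfloor>" for t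
  have c: "c t ^ 3 \<le> t" "t \<le> Suc (c t) ^ 3" for t
  proof -
    have "real (c t) \<le> root 3 (real t)" "root 3 (real t) \<le> real (Suc (c t))"
      unfolding c_def by (simp, linarith)
    then have "real (c t) ^ 3 \<le> root 3 (real t) ^ 3" "root 3 (real t) ^ 3 \<le> real (Suc (c t)) ^ 3"
      by - (rule power_mono; simp)+
    then have "real (c t ^ 3) \<le> real t" "real t \<le> real (Suc (c t) ^ 3)"
      unfolding of_nat_power by (simp_all only: real_root_pow_pos2 of_nat_0_le_iff zero_less_numeral)
    then show "c t ^ 3 \<le> t" "t \<le> Suc (c t) ^ 3" by (simp_all only: of_nat_le_iff)
  qed
  have c_lim: "filterlim c sequentially sequentially"
  proof (rule filterlim_at_top[THEN iffD2, rule_format])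
    fix k
    have "k \<le> c t" if "t \<ge> Suc k ^ 3" for t
    proof -
      have "Suc k ^ 3 \<le> Suc (c t) ^ 3" using that c(2) by (rule order_trans)
      then show ?thesis using power_strict_mono[of "Suc (c t)" "Suc k" 3] by (meson Suc_less_eq leD leI zero_le zero_less_numeral)
    qed
    then show "eventually (\<lambda>t. k \<le> c t) sequentially"
      by (auto simp: eventually_sequentially)
  qed
  have inc: "\<bar>f t - f s\<bar> \<le> real (t - s) / real (Suc s)" if "s \<le> t" for s t
    using that
  proof (induction t rule: dec_induct)
    case (step t)
    have "\<bar>f (Suc t) - f t\<bar> \<le> 1 / real (Suc s)"
      using assms(1)[of t] step(1) by (intro order_trans[OF assms(1)] divide_left_mono) auto
    with step show ?case by (auto simp: Suc_diff_le add_divide_distrib)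
  qed simp
  have "(\<lambda>t. f t - f (c t ^ 3)) \<longlonglongrightarrow> 0"
  proof (rule Lim_null_comparison)
    \<comment> \<open>The constant is 7 = 3 + 3 + 1: for c t at least 1 each term of 3 k^2 + 3 k + 1
      is absorbed into k^2. The same restriction makes the division by the cube legitimate.\<close>
    show "eventually (\<lambda>t. norm (f t - f (c t ^ 3)) \<le> 7 / real (c t)) sequentially"
      using filterlim_at_top[THEN iffD1, rule_format, OF c_lim, of 1]
    proof eventually_elim
      case (elim t)
      have "real (t - c t ^ 3) \<le> real (Suc (c t) ^ 3 - c t ^ 3)"
        by (intro of_nat_mono diff_le_mono c)
      also have "\<dots> = 3 * real (c t) ^ 2 + 3 * real (c t) + 1"
        by (auto simp: power3_eq_cube power2_eq_square algebra_simps)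
      also have "\<dots> \<le> 7 * real (c t) ^ 2"
      proof -
        have "real (c t) \<le> real (c t) ^ 2" "1 \<le> real (c t) ^ 2"
          using elim by (auto simp: power2_eq_square one_le_power intro: mult_ge1_I)
        then show ?thesis by linarith
      qed
      finally have "real (t - c t ^ 3) \<le> 7 * real (c t) ^ 2" .
      moreover have "\<bar>f t - f (c t ^ 3)\<bar> \<le> real (t - c t ^ 3) / real (Suc (c t ^ 3))"
        by (rule inc[OF c(1)])
      ultimately have "\<bar>f t - f (c t ^ 3)\<bar> \<le> (7 * real (c t) ^ 2) / real (c t) ^ 3"
        using elim by (elim order_trans) (intro frac_le, auto)
      also have "\<dots> = 7 / real (c t)" using elim by (simp add: power2_eq_square power3_eq_cube)
      finally show ?case by simp
    qed
    show "(\<lambda>t. 7 / real (c t)) \<longlonglongrightarrow> 0"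
      by (intro real_tendsto_divide_at_top[OF tendsto_const]
          filterlim_compose[OF filterlim_real_sequentially c_lim])
  qed
  from tendsto_add[OF this filterlim_compose[OF L c_lim]] show ?thesis
    by (auto simp: convergent_def)
qed

text \<open>Sum and integral commute for nonnegative terms, so the random sum has finite expectation
  and is almost surely finite.\<close>

lemma (in prob_space) AE_summable_if_summable_expectation:
  fixes f :: "nat \<Rightarrow> 'a \<Rightarrow> real"
  assumes int: "\<And>k. integrable M (f k)" and nonneg: "\<And>k \<omega>. 0 \<le> f k \<omega>"
    and sum: "summable (\<lambda>k. expectation (f k))"
  shows "AE \<omega> in M. summable (\<lambda>k. f k \<omega>)"
proof -
  have [measurable]: "f k \<in> borel_measurable M" for k using int by auto
  have "(\<integral>\<^sup>+\<omega>. (\<Sum>k. ennreal (f k \<omega>)) \<partial>M) = (\<Sum>k. \<integral>\<^sup>+\<omega>. ennreal (f k \<omega>) \<partial>M)"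
    by (rule nn_integral_suminf) simp
  also have "\<dots> = (\<Sum>k. ennreal (expectation (f k)))"
    using int nonneg by (simp add: nn_integral_eq_integral)
  also have "\<dots> \<noteq> \<infinity>"
    using sum nonneg by (simp add: suminf_ennreal2 integral_nonneg)
  finally have "AE \<omega> in M. (\<Sum>k. ennreal (f k \<omega>)) \<noteq> \<infinity>"
    by (intro nn_integral_noteq_infinite) auto
  then show ?thesis
    by eventually_elim (auto intro!: summable_suminf_not_top nonneg)
qed

lemma pochhammer_of_nat_fact:
  assumes "1 \<le> k"
  shows "pochhammer (real k) m = fact (m + k - 1) / fact (k - 1)"
proof (induction m)
  case (Suc m)
  have "m + k = Suc (m + k - 1)" using assms by simp
  then have "fact (m + k) = (real m + real k) * (fact (m + k - 1) :: real)"
    by (metis fact_Suc of_nat_add)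
  with Suc show ?case by (simp add: pochhammer_Suc)
qed simp

text \<open>With x = k + 1 the gap is at most 3 x^2 and k^3 + 1 is at least x^3 / 4, which gives 3 *
  16 = 48. The leading factor x^2 is the weight given to the squared increments in the convergence
  proof; the bound remains summable in spite of it.\<close>

lemma cubes_gap_bound:
  "(real (Suc k))\<^sup>2 * (real (Suc k ^ 3 - k ^ 3) / (real (Suc (k ^ 3)))\<^sup>2) \<le> 48 / (real (Suc k))\<^sup>2"
proof -
  define x where "x = real (Suc k)"
  define y where "y = real (Suc (k ^ 3))"
  have x: "1 \<le> x" by (simp add: x_def)
  have kx: "real k = x - 1" by (simp add: x_def)
  have "real (Suc k ^ 3 - k ^ 3) = x ^ 3 - (x - 1) ^ 3"
    using kx by (subst of_nat_diff) (simp_all add: x_def power_mono)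
  also have "\<dots> \<le> 3 * x\<^sup>2"
    using x by (simp add: power2_eq_square power3_eq_cube algebra_simps)
  finally have gap: "real (Suc k ^ 3 - k ^ 3) \<le> 3 * x\<^sup>2" .
  \<comment> \<open>A perfect square certifying that 4 (k^3 + 1) dominates (k + 1)^3; equality
    occurs at k = 1.\<close>
  have "0 \<le> 3 * x * (x - 2)\<^sup>2" using x by simp
  also have "3 * x * (x - 2)\<^sup>2 = 4 * ((x - 1) ^ 3 + 1) - x ^ 3"
    by (simp add: power2_eq_square power3_eq_cube algebra_simps)
  finally have y: "x ^ 3 / 4 \<le> y" by (simp add: y_def kx)
  have y2: "(x ^ 3 / 4)\<^sup>2 \<le> y\<^sup>2" using x y by (intro power_mono) auto
  have "x\<^sup>2 * (real (Suc k ^ 3 - k ^ 3) / y\<^sup>2) \<le> x\<^sup>2 * (3 * x\<^sup>2 / (x ^ 3 / 4)\<^sup>2)"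
    using gap y2 x by (intro mult_left_mono frac_le) auto
  also have "\<dots> = 48 / x\<^sup>2"
    using x by (simp add: field_simps eval_nat_numeral)
  finally show ?thesis by (simp only: x_def y_def)
qed

section \<open>Re-indexing the off-diagonal entries of a row\<close>

definition insert_pos :: "nat \<Rightarrow> nat \<Rightarrow> nat" where
  "insert_pos i j = (if j < i then j else j + 1)"

text \<open>Inverse to \<open>insert_pos i\<close> on the players other than i; the two maps
  translate between players and the positions used by \<open>remove_entry\<close>.\<close>

definition remove_pos :: "nat \<Rightarrow> nat \<Rightarrow> nat" where
  "remove_pos i l = (if l < i then l else l - 1)"

lemma remove_pos_insert_pos [simp]: "remove_pos i (insert_pos i j) = j"
  by (simp add: remove_pos_def insert_pos_def)

lemma bij_betw_insert_pos:
  assumes "i \<in> {1..n}"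
  shows "bij_betw (insert_pos i) {1..n - 1} ({1..n} - {i})"
  by (rule bij_betwI[where g = "remove_pos i"])
    (use assms in \<open>auto simp: insert_pos_def remove_pos_def split: if_splits\<close>)

lemma remove_entry_eq: "remove_entry n i x = (\<lambda>j\<in>{1..n - 1}. x (insert_pos i j))"
  by (simp add: remove_entry_def insert_pos_def)

section \<open>The process\<close>

context friends_I
begin

section \<open>Measurability with respect to the past, and elementary facts about weights\<close>

lemma measurable_V_past:
  assumes "s < t" "i \<in> {1..n}"
  shows "V s i \<in> past M n V t \<rightarrow>\<^sub>M count_space UNIV"
proof -
  have "(\<lambda>\<omega>. \<lambda>(s, i)\<in>{..<t} \<times> {1..n}. V s i \<omega>)
      \<in> past M n V t \<rightarrow>\<^sub>M Pi\<^sub>M ({..<t} \<times> {1..n}) (\<lambda>_. count_space UNIV)"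
    unfolding past_def by (rule measurable_vimage_algebra1) (auto simp: space_PiM)
  from measurable_compose[OF this measurable_component_singleton[of "(s, i)"]] assms
  show ?thesis by simp
qed

lemma measurable_weight_past:
  assumes "s \<le> t" "i \<in> {1..n}"
  shows "weight V s i j \<in> borel_measurable (past M n V t)"
  using assms(1)
proof (induction s)
  case (Suc s)
  note [measurable] = measurable_V_past[of s t i] Suc.IH
  have "s < t" using Suc.prems by simp
  with Suc assms(2) show ?case by (simp add: Suc.IH[OF less_imp_le] measurable_V_past)
next
  case 0
  have "weight V 0 i j = (\<lambda>_. if i = j then 0 else 1)" by (rule ext) simp
  then show ?case by simp
qed

lemma measurable_visit_prob_past:
  assumes "s \<le> t" "i \<in> {1..n}"
  shows "visit_prob n V s i j \<in> borel_measurable (past M n V t)"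
  unfolding visit_prob_def[abs_def] using measurable_weight_past[OF assms] by measurable

lemma measurable_weight[measurable]: "i \<in> {1..n} \<Longrightarrow> weight V t i j \<in> borel_measurable M"
  using measurable_from_subalg[OF past_subalgebra measurable_weight_past] by blast

lemma measurable_visit_prob[measurable]: "i \<in> {1..n} \<Longrightarrow> visit_prob n V t i j \<in> borel_measurable M"
  using measurable_from_subalg[OF past_subalgebra measurable_visit_prob_past] by blast

lemma measurable_V[measurable]: "i \<in> {1..n} \<Longrightarrow> V t i \<in> M \<rightarrow>\<^sub>M count_space UNIV"
  using measurable_from_subalg[OF past_subalgebra measurable_V_past[of t "Suc t"]] by blast

lemma V_in: "i \<in> {1..n} \<Longrightarrow> \<omega> \<in> space M \<Longrightarrow> V t i \<omega> \<in> {1..n} - {i}"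
  using measurable_space[OF visits] by auto

lemma weight_nonneg: "0 \<le> weight V t i j \<omega>"
  by (induction t) auto

lemma weight_Suc_row:
  "(\<lambda>j. weight V (Suc t) i j \<omega>) = (\<lambda>j. weight V t i j \<omega>)(V t i \<omega> := weight V t i (V t i \<omega>) \<omega> + 1)"
  by auto

lemma weight_diag: "i \<in> {1..n} \<Longrightarrow> \<omega> \<in> space M \<Longrightarrow> weight V t i i \<omega> = 0"
  using V_in[of i \<omega>] by (induction t) auto

text \<open>A row starts with total n - 1 and every round adds exactly one, so the denominator of
  the visiting probabilities is deterministic.\<close>

lemma sum_weight:
  assumes "i \<in> {1..n}" "\<omega> \<in> space M"
  shows "(\<Sum>k\<in>{1..n}. weight V t i k \<omega>) = real (n - 1 + t)"
proof (induction t)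
  case 0
  have "(\<Sum>k\<in>{1..n}. weight V 0 i k \<omega>) = (\<Sum>k\<in>{1..n} - {i}. 1)"
    by (rule sum.mono_neutral_cong_right) auto
  then show ?case using assms by simp
next
  case (Suc t)
  have "V t i \<omega> \<in> {1..n}" using V_in[OF assms] by auto
  then show ?case using Suc by (simp add: sum.distrib)
qed

lemma sum_weight_off_diag:
  assumes "i \<in> {1..n}" "\<omega> \<in> space M"
  shows "(\<Sum>k\<in>{1..n} - {i}. weight V t i k \<omega>) = real (n - 1 + t)"
  using sum_weight[OF assms] weight_diag[OF assms] assms(1) by (simp add: sum.remove[of _ i])

lemma visit_prob_eq:
  "i \<in> {1..n} \<Longrightarrow> \<omega> \<in> space M \<Longrightarrow> visit_prob n V t i j \<omega> = weight V t i j \<omega> / real (n - 1 + t)"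
  unfolding visit_prob_def using sum_weight by simp

lemma visit_prob_bounds:
  assumes "i \<in> {1..n}" "j \<in> {1..n}"
  shows "0 \<le> visit_prob n V t i j \<omega>" "visit_prob n V t i j \<omega> \<le> 1"
proof -
  have "weight V t i j \<omega> \<le> (\<Sum>k\<in>{1..n}. weight V t i k \<omega>)"
    using assms by (intro member_le_sum) (auto simp: weight_nonneg)
  then show "0 \<le> visit_prob n V t i j \<omega>" "visit_prob n V t i j \<omega> \<le> 1"
    using weight_nonneg[of t i j \<omega>] by (auto simp: visit_prob_def divide_le_eq_1)
qed

text \<open>This is where the assumption \<open>choices\<close> enters. The space is split according
  to the joint choice c; on each piece the factors are functions of the past, so the indicator of
  the piece may be replaced by its conditional expectation, a product over the players. Summing over
  c factorises again.\<close>

lemma expectation_prod_choices: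
  assumes h: "\<And>i j. i \<in> {1..n} \<Longrightarrow> j \<in> {1..n} \<Longrightarrow> h i j \<in> borel_measurable (past M n V t)"
    and bd: "\<And>i j \<omega>. i \<in> {1..n} \<Longrightarrow> j \<in> {1..n} \<Longrightarrow> \<omega> \<in> space M \<Longrightarrow> \<bar>h i j \<omega>\<bar> \<le> B"
  shows "expectation (\<lambda>\<omega>. \<Prod>i\<in>{1..n}. h i (V t i \<omega>) \<omega>)
    = expectation (\<lambda>\<omega>. \<Prod>i\<in>{1..n}. \<Sum>j\<in>{1..n}. visit_prob n V t i j \<omega> * h i j \<omega>)"
proof -
  \<comment> \<open>Self-visits are kept among the joint choices, so that the range is a full
    product and the final sum factorises.\<close>
  let ?C = "PiE {1..n} (\<lambda>_. {1..n})"
  interpret past: finite_measure_subalgebra M "past M n V t"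
    by unfold_locales (rule past_subalgebra)
  define A where "A c = {\<omega> \<in> space M. \<forall>i\<in>{1..n}. V t i \<omega> = c i}" for c
  have [measurable]: "A c \<in> sets M" for c unfolding A_def by measurable
  define g where "g c \<omega> = (\<Prod>i\<in>{1..n}. h i (c i) \<omega>)" for c \<omega>
  have g: "g c \<in> borel_measurable (past M n V t)" if "c \<in> ?C" for c
    unfolding g_def[abs_def] using that by (intro borel_measurable_prod h) auto
  have gM: "g c \<in> borel_measurable M" if "c \<in> ?C" for c
    using measurable_from_subalg[OF past_subalgebra g[OF that]] .
  have g_bd: "\<bar>g c \<omega>\<bar> \<le> B ^ n" if "c \<in> ?C" "\<omega> \<in> space M" for c \<omega>
  proof -
    have "\<bar>g c \<omega>\<bar> \<le> (\<Prod>i\<in>{1..n}. B)"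
      unfolding g_def abs_prod using that by (intro prod_mono) (auto intro!: bd)
    then show ?thesis by simp
  qed
  have int: "integrable M (\<lambda>\<omega>. g c \<omega> * indicator (A c) \<omega>)" if "c \<in> ?C" for c
  proof (rule integrable_const_bound[of _ "B ^ n"])
    show "AE \<omega> in M. norm (g c \<omega> * indicator (A c) \<omega>) \<le> B ^ n"
    proof (rule AE_I2)
      fix \<omega> assume "\<omega> \<in> space M"
      then show "norm (g c \<omega> * indicator (A c) \<omega>) \<le> B ^ n"
        using g_bd[OF that, of \<omega>] abs_ge_zero[of "g c \<omega>"] by (simp add: indicator_def del: abs_ge_zero)
    qed
    show "(\<lambda>\<omega>. g c \<omega> * indicator (A c) \<omega>) \<in> borel_measurable M"
      by (intro borel_measurable_times borel_measurable_indicator gM[OF that]) simp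
  qed
  \<comment> \<open>The factor measurable with respect to the past is pulled out of the conditional
    expectation.\<close>
  have step: "expectation (\<lambda>\<omega>. g c \<omega> * indicator (A c) \<omega>)
      = expectation (\<lambda>\<omega>. g c \<omega> * (\<Prod>i\<in>{1..n}. visit_prob n V t i (c i) \<omega>))"
    and int': "integrable M (\<lambda>\<omega>. g c \<omega> * (\<Prod>i\<in>{1..n}. visit_prob n V t i (c i) \<omega>))" if c: "c \<in> ?C" for c
  proof -
    have cond: "AE \<omega> in M. real_cond_exp M (past M n V t) (indicator (A c)) \<omega> = (\<Prod>i\<in>{1..n}. visit_prob n V t i (c i) \<omega>)"
      unfolding A_def using c by (intro choices) auto
    have [measurable]: "(\<lambda>\<omega>. g c \<omega> * (\<Prod>i\<in>{1..n}. visit_prob n V t i (c i) \<omega>)) \<in> borel_measurable M"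
      using gM[OF c] by (intro borel_measurable_times borel_measurable_prod) auto
    note [measurable] = gM[OF c]
    have eq: "AE \<omega> in M. g c \<omega> * real_cond_exp M (past M n V t) (indicator (A c)) \<omega>
        = g c \<omega> * (\<Prod>i\<in>{1..n}. visit_prob n V t i (c i) \<omega>)"
      using cond by eventually_elim simp
    note i = past.real_cond_exp_intg[OF int[OF c] g[OF c]]
    show "integrable M (\<lambda>\<omega>. g c \<omega> * (\<Prod>i\<in>{1..n}. visit_prob n V t i (c i) \<omega>))"
      using i(1) by (subst integrable_cong_AE[OF _ _ eq, symmetric]) auto
    have "expectation (\<lambda>\<omega>. g c \<omega> * real_cond_exp M (past M n V t) (indicator (A c)) \<omega>)
        = expectation (\<lambda>\<omega>. g c \<omega> * (\<Prod>i\<in>{1..n}. visit_prob n V t i (c i) \<omega>))"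
      by (rule integral_cong_AE[OF _ _ eq]) auto
    with i(2) show "expectation (\<lambda>\<omega>. g c \<omega> * indicator (A c) \<omega>)
      = expectation (\<lambda>\<omega>. g c \<omega> * (\<Prod>i\<in>{1..n}. visit_prob n V t i (c i) \<omega>))"
      by simp
  qed
  have fin: "finite ?C" by (intro finite_PiE) auto
  \<comment> \<open>Exactly one joint choice occurs at each outcome, namely the actual one,
    v.\<close>
  have split: "(\<Prod>i\<in>{1..n}. h i (V t i \<omega>) \<omega>) = (\<Sum>c\<in>?C. g c \<omega> * indicator (A c) \<omega>)" if w: "\<omega> \<in> space M" for \<omega>
  proof -
    define v where "v = (\<lambda>i\<in>{1..n}. V t i \<omega>)"
    have v: "v \<in> ?C" using V_in[OF _ w] by (auto simp: v_def)
    have "indicator (A c) \<omega> = (if c = v then 1 else 0 :: real)" if "c \<in> ?C" for c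
    proof -
      have "c = v" if "\<omega> \<in> A c"
        using that by (intro PiE_ext[OF \<open>c \<in> ?C\<close> v]) (simp add: A_def v_def)
      moreover have "\<omega> \<in> A v" using w by (simp add: A_def v_def)
      ultimately have "\<omega> \<in> A c \<longleftrightarrow> c = v" by blast
      then show ?thesis by (simp only: indicator_def of_bool_def)
    qed
    then have "(\<Sum>c\<in>?C. g c \<omega> * indicator (A c) \<omega>) = (\<Sum>c\<in>?C. if c = v then g c \<omega> else 0)"
      by (intro sum.cong) auto
    also have "\<dots> = g v \<omega>" using fin v by simp
    finally show ?thesis by (simp add: g_def v_def)
  qed
  have "expectation (\<lambda>\<omega>. \<Prod>i\<in>{1..n}. h i (V t i \<omega>) \<omega>) = expectation (\<lambda>\<omega>. \<Sum>c\<in>?C. g c \<omega> * indicator (A c) \<omega>)"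
    by (intro Bochner_Integration.integral_cong refl split)
  also have "\<dots> = (\<Sum>c\<in>?C. expectation (\<lambda>\<omega>. g c \<omega> * indicator (A c) \<omega>))"
    using int by (intro Bochner_Integration.integral_sum)
  also have "\<dots> = (\<Sum>c\<in>?C. expectation (\<lambda>\<omega>. g c \<omega> * (\<Prod>i\<in>{1..n}. visit_prob n V t i (c i) \<omega>)))"
    using step by (intro sum.cong) auto
  also have "\<dots> = expectation (\<lambda>\<omega>. \<Sum>c\<in>?C. g c \<omega> * (\<Prod>i\<in>{1..n}. visit_prob n V t i (c i) \<omega>))"
    using int' by (intro Bochner_Integration.integral_sum[symmetric])
  also have "\<dots> = expectation (\<lambda>\<omega>. \<Prod>i\<in>{1..n}. \<Sum>j\<in>{1..n}. visit_prob n V t i j \<omega> * h i j \<omega>)"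
    \<comment> \<open>Distributivity turns the sum over joint choices into a product of sums, one
      for each player.\<close>
    by (subst prod_sum_PiE) (auto simp: g_def prod.distrib mult_ac)
  finally show ?thesis .
qed

text \<open>With the diagonal set to 0 outright, a full row can be recovered from
  \<open>remove_entry\<close> at every outcome, without an exceptional set. Where no limit exists,
  \<open>lim\<close> is some value that only matters for measurability.\<close>

definition limit_prob :: "'a \<Rightarrow> nat \<Rightarrow> nat \<Rightarrow> real" where
  "limit_prob \<omega> i j = (if i = j then 0 else lim (\<lambda>t. visit_prob n V t i j \<omega>))"

lemma measurable_limit_prob[measurable]:
  "i \<in> {1..n} \<Longrightarrow> (\<lambda>\<omega>. limit_prob \<omega> i j) \<in> borel_measurable M"
  unfolding limit_prob_def by (cases "i = j") auto

context
  assumes n2: "2 \<le> n"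
begin

lemma sum_visit_prob:
  assumes "i \<in> {1..n}" "\<omega> \<in> space M"
  shows "(\<Sum>j\<in>{1..n}. visit_prob n V t i j \<omega>) = 1"
  using n2 sum_weight[OF assms, of t] by (simp add: visit_prob_def sum_divide_distrib[symmetric])

text \<open>The one-player case: the other players get the factor 1, and their sums collapse to 1
  because visiting probabilities sum to 1.\<close>

lemma expectation_choice:
  assumes i: "i \<in> {1..n}"
    and h: "\<And>j. j \<in> {1..n} \<Longrightarrow> h j \<in> borel_measurable (past M n V t)"
    and bd: "\<And>j \<omega>. j \<in> {1..n} \<Longrightarrow> \<omega> \<in> space M \<Longrightarrow> \<bar>h j \<omega>\<bar> \<le> B"
  shows "expectation (\<lambda>\<omega>. h (V t i \<omega>) \<omega>) = expectation (\<lambda>\<omega>. \<Sum>j\<in>{1..n}. visit_prob n V t i j \<omega> * h j \<omega>)"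
proof -
  define g where "g k j \<omega> = (if k = i then h j \<omega> else 1)" for k j \<omega>
  have "expectation (\<lambda>\<omega>. h (V t i \<omega>) \<omega>) = expectation (\<lambda>\<omega>. \<Prod>k\<in>{1..n}. g k (V t k \<omega>) \<omega>)"
  proof -
    have "(\<Prod>k\<in>{1..n}. g k (V t k \<omega>) \<omega>) = (\<Prod>k\<in>{1..n}. if k = i then h (V t i \<omega>) \<omega> else 1)" for \<omega>
      by (intro prod.cong) (auto simp: g_def)
    then show ?thesis using i by simp
  qed
  also have "\<dots> = expectation (\<lambda>\<omega>. \<Prod>k\<in>{1..n}. \<Sum>j\<in>{1..n}. visit_prob n V t k j \<omega> * g k j \<omega>)"
  proof (rule expectation_prod_choices[where B = "max B 1"])
    fix k j assume "k \<in> {1..n}" "j \<in> {1..n}"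
    then show "g k j \<in> borel_measurable (past M n V t)"
      unfolding g_def[abs_def] using h[of j] by (cases "k = i") auto
  qed (auto simp: g_def le_max_iff_disj bd)
  also have "\<dots> = expectation (\<lambda>\<omega>. \<Sum>j\<in>{1..n}. visit_prob n V t i j \<omega> * h j \<omega>)"
  proof (rule Bochner_Integration.integral_cong[OF refl])
    fix \<omega> assume w: "\<omega> \<in> space M"
    have "(\<Sum>j\<in>{1..n}. visit_prob n V t k j \<omega> * g k j \<omega>)
        = (if k = i then \<Sum>j\<in>{1..n}. visit_prob n V t i j \<omega> * h j \<omega> else 1)" if "k \<in> {1..n}" for k
      using sum_visit_prob[OF that w] by (simp add: g_def)
    then have "(\<Prod>k\<in>{1..n}. \<Sum>j\<in>{1..n}. visit_prob n V t k j \<omega> * g k j \<omega>)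
        = (\<Prod>k\<in>{1..n}. if k = i then \<Sum>j\<in>{1..n}. visit_prob n V t i j \<omega> * h j \<omega> else 1)"
      by (intro prod.cong) auto
    then show "(\<Prod>k\<in>{1..n}. \<Sum>j\<in>{1..n}. visit_prob n V t k j \<omega> * g k j \<omega>)
        = (\<Sum>j\<in>{1..n}. visit_prob n V t i j \<omega> * h j \<omega>)"
      using i by simp
  qed
  finally show ?thesis .
qed

section \<open>Martingale increments and almost sure convergence\<close>

lemma visit_prob_increment:
  assumes "i \<in> {1..n}" "\<omega> \<in> space M"
  shows "visit_prob n V (Suc t) i j \<omega> - visit_prob n V t i j \<omega>
    = ((if V t i \<omega> = j then 1 else 0) - visit_prob n V t i j \<omega>) / real (n + t)"
proof -
  \<comment> \<open>Here S is the row total before round t and S + 1 = n + t the total after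
    it.\<close>
  have alg: "(w + d) / (S + 1) - w / S = (d - w / S) / (S + 1)" if "0 < S" for w d S :: real
    using that by (simp add: field_simps)
  have S: "0 < real (n - 1 + t)" "real (n - 1 + Suc t) = real (n - 1 + t) + 1" "real (n + t) = real (n - 1 + t) + 1"
    using n2 by auto
  show ?thesis
    unfolding visit_prob_eq[OF assms] weight.simps S(2,3) by (rule alg[OF S(1)])
qed

lemma visit_prob_increment_bound:
  assumes "i \<in> {1..n}" "j \<in> {1..n}" "\<omega> \<in> space M"
  shows "\<bar>visit_prob n V (Suc t) i j \<omega> - visit_prob n V t i j \<omega>\<bar> \<le> 1 / real (Suc t)"
proof -
  have "\<bar>(if V t i \<omega> = j then 1 else 0) - visit_prob n V t i j \<omega>\<bar> \<le> 1"
    using visit_prob_bounds[OF assms(1,2), of t \<omega>] by auto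
  then show ?thesis
    unfolding visit_prob_increment[OF assms(1,3)] abs_divide using n2 by (intro frac_le) auto
qed

lemma visit_prob_diff_bound:
  assumes "i \<in> {1..n}" "j \<in> {1..n}"
  shows "\<bar>visit_prob n V t i j \<omega> - visit_prob n V s i j \<omega>\<bar> \<le> 1"
  using visit_prob_bounds[OF assms, of t \<omega>] visit_prob_bounds[OF assms, of s \<omega>] by auto

text \<open>Given the past of round t the first factor is fixed, while the increment has conditional
  mean 0.\<close>

lemma visit_prob_increment_orthogonal:
  assumes ij: "i \<in> {1..n}" "j \<in> {1..n}" and st: "s \<le> t"
  shows "expectation (\<lambda>\<omega>. (visit_prob n V t i j \<omega> - visit_prob n V s i j \<omega>)
    * (visit_prob n V (Suc t) i j \<omega> - visit_prob n V t i j \<omega>)) = 0"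
proof -
  \<comment> \<open>The integrand with the choice of player i frozen at l, so that only quantities
    of the past remain.\<close>
  define h where "h l \<omega> = (visit_prob n V t i j \<omega> - visit_prob n V s i j \<omega>)
      * (((if l = j then 1 else 0) - visit_prob n V t i j \<omega>) / real (n + t))" for l \<omega>
  have "expectation (\<lambda>\<omega>. (visit_prob n V t i j \<omega> - visit_prob n V s i j \<omega>)
      * (visit_prob n V (Suc t) i j \<omega> - visit_prob n V t i j \<omega>)) = expectation (\<lambda>\<omega>. h (V t i \<omega>) \<omega>)"
    unfolding h_def using ij
    by (intro Bochner_Integration.integral_cong refl) (simp only: visit_prob_increment)
  also have "\<dots> = expectation (\<lambda>\<omega>. \<Sum>l\<in>{1..n}. visit_prob n V t i l \<omega> * h l \<omega>)"
  proof (rule expectation_choice[OF ij(1), where B = 1])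
    show "h l \<in> borel_measurable (past M n V t)" for l
      unfolding h_def[abs_def]
      using measurable_visit_prob_past[OF st ij(1), of j] measurable_visit_prob_past[OF order_refl ij(1), of t j]
      by simp
    fix l \<omega>
    have "\<bar>((if l = j then 1 else 0) - visit_prob n V t i j \<omega>) / real (n + t)\<bar> \<le> 1 / 1"
      unfolding abs_divide using n2 visit_prob_bounds[OF ij, of t \<omega>] by (intro frac_le) auto
    then show "\<bar>h l \<omega>\<bar> \<le> 1"
      using visit_prob_diff_bound[OF ij, of t \<omega> s] unfolding h_def abs_mult by (intro mult_le_one) auto
  qed
  also have "\<dots> = expectation (\<lambda>\<omega>. 0)"
  proof (intro Bochner_Integration.integral_cong refl)
    fix \<omega> assume w: "\<omega> \<in> space M"
    \<comment> \<open>The martingale identity: the mean of the indicator of l = j under the current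
      visiting law is the visiting probability of j.\<close>
    have "(\<Sum>l\<in>{1..n}. visit_prob n V t i l \<omega> * ((if l = j then 1 else 0) - visit_prob n V t i j \<omega>))
        = (\<Sum>l\<in>{1..n}. if l = j then visit_prob n V t i j \<omega> else 0)
          - (\<Sum>l\<in>{1..n}. visit_prob n V t i l \<omega>) * visit_prob n V t i j \<omega>"
      unfolding sum_distrib_right sum_subtractf[symmetric] by (intro sum.cong) (auto simp: algebra_simps)
    also have "\<dots> = 0" using ij sum_visit_prob[OF ij(1) w] by simp
    finally have z: "(\<Sum>l\<in>{1..n}. visit_prob n V t i l \<omega> * ((if l = j then 1 else 0) - visit_prob n V t i j \<omega>)) = 0" .
    have "(\<Sum>l\<in>{1..n}. visit_prob n V t i l \<omega> * h l \<omega>)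
        = (visit_prob n V t i j \<omega> - visit_prob n V s i j \<omega>) / real (n + t)
          * (\<Sum>l\<in>{1..n}. visit_prob n V t i l \<omega> * ((if l = j then 1 else 0) - visit_prob n V t i j \<omega>))"
      unfolding sum_distrib_left h_def by (intro sum.cong) auto
    with z show "(\<Sum>l\<in>{1..n}. visit_prob n V t i l \<omega> * h l \<omega>) = 0" by simp
  qed
  finally show ?thesis by simp
qed

text \<open>By orthogonality the second moments of the t - s increments add up, and each is at most
  the square of 1 / (s + 1).\<close>

lemma expectation_visit_prob_diff_squared:
  assumes ij: "i \<in> {1..n}" "j \<in> {1..n}" and st: "s \<le> t"
  shows "expectation (\<lambda>\<omega>. (visit_prob n V t i j \<omega> - visit_prob n V s i j \<omega>)\<^sup>2) \<le> real (t - s) / (real (Suc s))\<^sup>2"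
  using st
proof (induction t rule: dec_induct)
  case (step t)
  define a b where "a \<omega> = visit_prob n V t i j \<omega> - visit_prob n V s i j \<omega>"
    and "b \<omega> = visit_prob n V (Suc t) i j \<omega> - visit_prob n V t i j \<omega>" for \<omega>
  have [measurable]: "a \<in> borel_measurable M" "b \<in> borel_measurable M"
    unfolding a_def[abs_def] b_def[abs_def] using ij by measurable
  have a1: "\<bar>a \<omega>\<bar> \<le> 1" and b1: "\<bar>b \<omega>\<bar> \<le> 1" for \<omega>
    unfolding a_def b_def by (rule visit_prob_diff_bound[OF ij])+
  have int: "integrable M (\<lambda>\<omega>. (a \<omega>)\<^sup>2)" "integrable M (\<lambda>\<omega>. a \<omega> * b \<omega>)" "integrable M (\<lambda>\<omega>. (b \<omega>)\<^sup>2)"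
    using a1 b1 by (auto intro!: integrable_bounded[of _ 1] simp: abs_mult mult_le_one abs_square_le_1)
  have b: "(b \<omega>)\<^sup>2 \<le> 1 / (real (Suc s))\<^sup>2" if "\<omega> \<in> space M" for \<omega>
  proof -
    have "\<bar>b \<omega>\<bar> \<le> 1 / real (Suc t)"
      unfolding b_def by (rule visit_prob_increment_bound[OF ij that])
    also have "\<dots> \<le> 1 / real (Suc s)" using step by (intro frac_le) auto
    finally have "\<bar>b \<omega>\<bar>\<^sup>2 \<le> (1 / real (Suc s))\<^sup>2" by (intro power_mono) auto
    then show ?thesis by (simp add: power_divide)
  qed
  have "expectation (\<lambda>\<omega>. (visit_prob n V (Suc t) i j \<omega> - visit_prob n V s i j \<omega>)\<^sup>2)
      = expectation (\<lambda>\<omega>. (a \<omega>)\<^sup>2 + 2 * (a \<omega> * b \<omega>) + (b \<omega>)\<^sup>2)"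
    by (intro Bochner_Integration.integral_cong) (auto simp: a_def b_def power2_eq_square algebra_simps)
  also have "\<dots> = expectation (\<lambda>\<omega>. (a \<omega>)\<^sup>2) + 2 * expectation (\<lambda>\<omega>. a \<omega> * b \<omega>) + expectation (\<lambda>\<omega>. (b \<omega>)\<^sup>2)"
    using int by simp
  also have "expectation (\<lambda>\<omega>. a \<omega> * b \<omega>) = 0"
    unfolding a_def b_def by (rule visit_prob_increment_orthogonal[OF ij step(1)])
  also have "expectation (\<lambda>\<omega>. (b \<omega>)\<^sup>2) \<le> expectation (\<lambda>\<omega>. 1 / (real (Suc s))\<^sup>2)"
    using int b by (intro integral_mono) auto
  finally have "expectation (\<lambda>\<omega>. (visit_prob n V (Suc t) i j \<omega> - visit_prob n V s i j \<omega>)\<^sup>2)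
      \<le> expectation (\<lambda>\<omega>. (a \<omega>)\<^sup>2) + 1 / (real (Suc s))\<^sup>2" by (simp add: prob_space)
  also have "\<dots> \<le> real (t - s) / (real (Suc s))\<^sup>2 + 1 / (real (Suc s))\<^sup>2"
    using step.IH by (simp add: a_def)
  also have "\<dots> = real (Suc t - s) / (real (Suc s))\<^sup>2"
    using step(1) by (simp add: Suc_diff_le add_divide_distrib)
  finally show ?case .
qed simp

text \<open>Second moments control squares, whereas the cubic criterion needs summable absolute
  increments. Weighting the squares by (k + 1)^2 bridges the two: the weighted squares still have
  summable expectations, and they dominate the absolute values up to a summable term.\<close>

lemma AE_convergent_visit_prob:
  assumes ij: "i \<in> {1..n}" "j \<in> {1..n}"
  shows "AE \<omega> in M. convergent (\<lambda>t. visit_prob n V t i j \<omega>)"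
proof -
  define d where "d k \<omega> = visit_prob n V (Suc k ^ 3) i j \<omega> - visit_prob n V (k ^ 3) i j \<omega>" for k \<omega>
  define f where "f k \<omega> = (real (Suc k))\<^sup>2 * (d k \<omega>)\<^sup>2" for k \<omega>
  have [measurable]: "d k \<in> borel_measurable M" for k
    unfolding d_def[abs_def] using ij by measurable
  have d1: "\<bar>d k \<omega>\<bar> \<le> 1" for k \<omega>
    unfolding d_def by (rule visit_prob_diff_bound[OF ij])
  have int: "integrable M (\<lambda>\<omega>. (d k \<omega>)\<^sup>2)" for k
    using d1 by (auto intro!: integrable_bounded[of _ 1] simp: abs_square_le_1)
  have Ef: "expectation (f k) \<le> 48 / (real (Suc k))\<^sup>2" for k
  proof -
    have "expectation (f k) = (real (Suc k))\<^sup>2 * expectation (\<lambda>\<omega>. (d k \<omega>)\<^sup>2)"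
      unfolding f_def[abs_def] by simp
    also have "\<dots> \<le> (real (Suc k))\<^sup>2 * (real (Suc k ^ 3 - k ^ 3) / (real (Suc (k ^ 3)))\<^sup>2)"
      unfolding d_def
      by (rule mult_left_mono[OF expectation_visit_prob_diff_squared[OF ij power_mono]]) auto
    also have "\<dots> \<le> 48 / (real (Suc k))\<^sup>2" by (rule cubes_gap_bound)
    finally show ?thesis .
  qed
  have inv: "summable (\<lambda>k. 1 / (real (Suc k))\<^sup>2)"
    using sums_summable[OF inverse_squares_sums] by (simp add: add_ac)
  have "summable (\<lambda>k. expectation (f k))"
  proof (rule summable_comparison_test')
    show "summable (\<lambda>k. 48 / (real (Suc k))\<^sup>2)" using summable_mult[OF inv, of 48] by simp
    show "norm (expectation (f k)) \<le> 48 / (real (Suc k))\<^sup>2" for k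
      using Ef[of k] by (simp add: integral_nonneg f_def)
  qed
  then have "AE \<omega> in M. summable (\<lambda>k. f k \<omega>)"
    unfolding f_def using int by (intro AE_summable_if_summable_expectation integrable_mult_right) auto
  then show ?thesis
    using AE_space
  proof eventually_elim
    case (elim \<omega>)
    have "\<bar>d k \<omega>\<bar> \<le> f k \<omega> + 1 / (real (Suc k))\<^sup>2" for k
    proof -
      define x where "x = real (Suc k)"
      have x: "x > 0" by (simp add: x_def)
      \<comment> \<open>The arithmetic-geometric mean inequality for x * |d| and 1 / x.\<close>
      have "0 \<le> (x * \<bar>d k \<omega>\<bar> - 1 / x)\<^sup>2" by simp
      also have "\<dots> = x\<^sup>2 * (d k \<omega>)\<^sup>2 - 2 * \<bar>d k \<omega>\<bar> + 1 / x\<^sup>2"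
        using x by (simp add: power2_diff power_mult_distrib power_divide)
      finally have "2 * \<bar>d k \<omega>\<bar> \<le> f k \<omega> + 1 / x\<^sup>2" by (simp add: f_def x_def)
      then show ?thesis unfolding x_def by linarith
    qed
    then have "summable (\<lambda>k. \<bar>d k \<omega>\<bar>)"
      by (intro summable_comparison_test'[OF summable_add[OF elim(1) inv]]) (simp only: real_norm_def abs_abs)
    then show ?case
      unfolding d_def using visit_prob_increment_bound[OF ij elim(2)]
      by (intro convergent_if_cubic_subsequence)
  qed
qed

section \<open>Mixed moments of the limit matrix\<close>

lemma weight_off_diag_ratio:
  "i \<in> {1..n} \<Longrightarrow> \<omega> \<in> space M \<Longrightarrow>
    weight V t i j \<omega> / (\<Sum>k\<in>{1..n} - {i}. weight V t i k \<omega>) = visit_prob n V t i j \<omega>"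
  by (simp only: sum_weight_off_diag visit_prob_eq)

abbreviation row_ratio :: "(nat \<Rightarrow> nat \<Rightarrow> nat) \<Rightarrow> nat \<Rightarrow> nat \<Rightarrow> 'a \<Rightarrow> real" where
  "row_ratio m t i \<omega> \<equiv> polya_ratio ({1..n} - {i}) (m i) (\<lambda>j. weight V t i j \<omega>)"

text \<open>\<open>expectation_prod_choices\<close> averages over the next choices row by row, and
  \<open>polya_ratio_step\<close> collapses each average to the current ratio. Treating the product
  over all rows at once is what later yields independence.\<close>

lemma expectation_prod_row_ratio_Suc:
  "expectation (\<lambda>\<omega>. \<Prod>i\<in>{1..n}. row_ratio m (Suc t) i \<omega>) = expectation (\<lambda>\<omega>. \<Prod>i\<in>{1..n}. row_ratio m t i \<omega>)"
proof -
  \<comment> \<open>The ratio of row i after a visit to l. A self-visit never happens, and the value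
    0 there lets the sum run over all players although the urn of row i omits colour i.\<close>
  define h where "h i l \<omega> = (if l = i then 0 else
      polya_ratio ({1..n} - {i}) (m i) ((\<lambda>j. weight V t i j \<omega>)(l := weight V t i l \<omega> + 1)))" for i l \<omega>
  define B where "B i = (\<Prod>j\<in>{1..n} - {i}. fact (m i j) :: real)" for i
  have B1: "1 \<le> B i" for i unfolding B_def by (intro prod_ge_1) auto
  have "expectation (\<lambda>\<omega>. \<Prod>i\<in>{1..n}. row_ratio m (Suc t) i \<omega>) = expectation (\<lambda>\<omega>. \<Prod>i\<in>{1..n}. h i (V t i \<omega>) \<omega>)"
  proof (intro Bochner_Integration.integral_cong refl prod.cong)
    fix \<omega> i assume "\<omega> \<in> space M" "i \<in> {1..n}"
    then show "row_ratio m (Suc t) i \<omega> = h i (V t i \<omega>) \<omega>"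
      using V_in[of i \<omega> t] unfolding weight_Suc_row h_def by auto
  qed
  also have "\<dots> = expectation (\<lambda>\<omega>. \<Prod>i\<in>{1..n}. \<Sum>l\<in>{1..n}. visit_prob n V t i l \<omega> * h i l \<omega>)"
  \<comment> \<open>One bound must serve all rows; since every \<open>B i\<close> is at least 1,
    their product dominates each of them.\<close>
  proof (rule expectation_prod_choices[where B = "\<Prod>i\<in>{1..n}. B i"])
    fix i l assume il: "i \<in> {1..n}" "l \<in> {1..n}"
    note [measurable] = measurable_weight_past[OF order_refl il(1), of t]
    have "(\<lambda>\<omega>. ((\<lambda>j. weight V t i j \<omega>)(l := weight V t i l \<omega> + 1)) j) \<in> borel_measurable (past M n V t)" for j
      by (cases "j = l") auto
    then show "h i l \<in> borel_measurable (past M n V t)"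
      unfolding h_def[abs_def] polya_ratio_def pochhammer_prod
      by (intro measurable_If borel_measurable_divide borel_measurable_prod borel_measurable_sum
          borel_measurable_add borel_measurable_const) auto
    fix \<omega> assume w: "\<omega> \<in> space M"
    have "\<bar>h i l \<omega>\<bar> \<le> B i"
    proof (cases "l = i")
      case False
      let ?w = "(\<lambda>j. weight V t i j \<omega>)(l := weight V t i l \<omega> + 1)"
      have "(\<Sum>j\<in>{1..n} - {i}. weight V t i j \<omega>) \<le> (\<Sum>j\<in>{1..n} - {i}. ?w j)"
        by (intro sum_mono) auto
      then have "1 \<le> (\<Sum>j\<in>{1..n} - {i}. ?w j)"
        using sum_weight_off_diag[OF il(1) w, of t] n2 by simp
      then have "0 \<le> polya_ratio ({1..n} - {i}) (m i) ?w" "polya_ratio ({1..n} - {i}) (m i) ?w \<le> B i"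
        unfolding B_def by (intro polya_ratio_bounds; simp add: weight_nonneg)+
      with False show ?thesis by (simp add: h_def)
    qed (use B1[of i] in \<open>simp add: h_def\<close>)
    also have "B i \<le> (\<Prod>i\<in>{1..n}. B i)"
    proof -
      have "1 \<le> (\<Prod>k\<in>{1..n} - {i}. B k)" using B1 by (intro prod_ge_1) auto
      then have "B i * 1 \<le> B i * (\<Prod>k\<in>{1..n} - {i}. B k)"
        using B1[of i] by (intro mult_left_mono) auto
      also have "\<dots> = (\<Prod>k\<in>{1..n}. B k)" using il by (subst prod.remove[of _ i]) auto
      finally show ?thesis by simp
    qed
    finally show "\<bar>h i l \<omega>\<bar> \<le> (\<Prod>i\<in>{1..n}. B i)" .
  qed
  also have "\<dots> = expectation (\<lambda>\<omega>. \<Prod>i\<in>{1..n}. row_ratio m t i \<omega>)"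
  proof (intro Bochner_Integration.integral_cong refl prod.cong)
    fix \<omega> i assume w: "\<omega> \<in> space M" and i: "i \<in> {1..n}"
    have "(\<Sum>l\<in>{1..n}. visit_prob n V t i l \<omega> * h i l \<omega>)
        = (\<Sum>l\<in>{1..n} - {i}. visit_prob n V t i l \<omega> * h i l \<omega>)"
      using i by (subst sum.remove[of _ i]) (auto simp: h_def)
    also have "\<dots> = (\<Sum>l\<in>{1..n} - {i}. weight V t i l \<omega> / (\<Sum>k\<in>{1..n} - {i}. weight V t i k \<omega>) *
        polya_ratio ({1..n} - {i}) (m i) ((\<lambda>j. weight V t i j \<omega>)(l := weight V t i l \<omega> + 1)))"
    proof (rule sum.cong[OF refl])
      fix l assume "l \<in> {1..n} - {i}"
      then have "l \<noteq> i" by blast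
      then show "visit_prob n V t i l \<omega> * h i l \<omega>
        = weight V t i l \<omega> / (\<Sum>k\<in>{1..n} - {i}. weight V t i k \<omega>) *
          polya_ratio ({1..n} - {i}) (m i) ((\<lambda>j. weight V t i j \<omega>)(l := weight V t i l \<omega> + 1))"
        by (simp only: h_def weight_off_diag_ratio[OF i w] if_False)
    qed
    also have "\<dots> = row_ratio m t i \<omega>"
      using n2 sum_weight_off_diag[OF i w, of t] by (intro polya_ratio_step) auto
    finally show "(\<Sum>l\<in>{1..n}. visit_prob n V t i l \<omega> * h i l \<omega>) = row_ratio m t i \<omega>" .
  qed
  finally show ?thesis .
qed

text \<open>The expectation is that of round 0, where all off-diagonal weights are 1: rising
  factorials of 1 are factorials, and the row total is n - 1. The unsimplified
  \<open>(n - 1) - 1\<close> matches the Dirichlet moments of length n - 1.\<close>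

lemma expectation_prod_row_ratio:
  "expectation (\<lambda>\<omega>. \<Prod>i\<in>{1..n}. row_ratio m t i \<omega>)
    = (\<Prod>i\<in>{1..n}. fact (n - 2) * (\<Prod>j\<in>{1..n} - {i}. fact (m i j))
        / fact ((\<Sum>j\<in>{1..n} - {i}. m i j) + (n - 1) - 1))"
proof (induction t)
  case 0
  have "row_ratio m 0 i \<omega> = fact (n - 2) * (\<Prod>j\<in>{1..n} - {i}. fact (m i j))
        / fact ((\<Sum>j\<in>{1..n} - {i}. m i j) + (n - 1) - 1)" if "i \<in> {1..n}" for i \<omega>
  proof -
    have "(\<Sum>j\<in>{1..n} - {i}. weight V 0 i j \<omega>) = (\<Sum>j\<in>{1..n} - {i}. 1)"
      by (rule sum.cong) auto
    then have "(\<Sum>j\<in>{1..n} - {i}. weight V 0 i j \<omega>) = real (n - 1)" using that by simp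
    moreover have "(\<Prod>j\<in>{1..n} - {i}. pochhammer (weight V 0 i j \<omega>) (m i j)) = (\<Prod>j\<in>{1..n} - {i}. fact (m i j))"
      by (rule prod.cong) (auto simp: pochhammer_fact)
    moreover have "n - 1 - 1 = n - 2" by simp
    ultimately show ?thesis
      using n2 pochhammer_of_nat_fact[of "n - 1"] by (simp only: polya_ratio_def) simp
  qed
  then have "(\<Prod>i\<in>{1..n}. row_ratio m 0 i \<omega>) = (\<Prod>i\<in>{1..n}. fact (n - 2) * (\<Prod>j\<in>{1..n} - {i}. fact (m i j))
        / fact ((\<Sum>j\<in>{1..n} - {i}. m i j) + (n - 1) - 1))" for \<omega>
    by (intro prod.cong refl) blast
  then show ?case by (simp only:) (simp add: prob_space)
qed (simp only: expectation_prod_row_ratio_Suc)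

lemma AE_visit_prob_tendsto:
  "AE \<omega> in M. \<forall>i\<in>{1..n}. \<forall>j\<in>{1..n}. (\<lambda>t. visit_prob n V t i j \<omega>) \<longlonglongrightarrow> limit_prob \<omega> i j"
proof -
  have "AE \<omega> in M. \<forall>i\<in>{1..n}. \<forall>j\<in>{1..n}. convergent (\<lambda>t. visit_prob n V t i j \<omega>)"
    using AE_convergent_visit_prob by (simp add: AE_finite_all)
  then show ?thesis
    using AE_space
  proof eventually_elim
    case (elim \<omega>)
    show ?case
    proof (intro ballI)
      fix i j assume ij: "i \<in> {1..n}" "j \<in> {1..n}"
      show "(\<lambda>t. visit_prob n V t i j \<omega>) \<longlonglongrightarrow> limit_prob \<omega> i j"
      proof (cases "i = j")
        case True
        then have "visit_prob n V t i j \<omega> = 0" for t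
          using weight_diag[OF ij(1) elim(2)] by (simp add: visit_prob_def)
        with True show ?thesis by (simp add: limit_prob_def)
      next
        case False
        with elim(1) ij show ?thesis by (simp add: limit_prob_def convergent_LIMSEQ_iff)
      qed
    qed
  qed
qed

lemma AE_limit_prob_unit:
  assumes "i \<in> {1..n}" "j \<in> {1..n}"
  shows "AE \<omega> in M. limit_prob \<omega> i j \<in> {0..1}"
  using AE_visit_prob_tendsto
proof eventually_elim
  case (elim \<omega>)
  then have "(\<lambda>t. visit_prob n V t i j \<omega>) \<longlonglongrightarrow> limit_prob \<omega> i j" using assms by blast
  then show ?case
    using visit_prob_bounds[OF assms]
    by (auto intro: LIMSEQ_le_const LIMSEQ_le_const2)
qed

text \<open>The products of ratios have constant expectation, converge almost surely to the monomial
  and are uniformly bounded, so dominated convergence passes the constant to the limit.\<close>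

lemma expectation_limit_prob_monomial:
  "expectation (\<lambda>\<omega>. \<Prod>i\<in>{1..n}. \<Prod>j\<in>{1..n} - {i}. limit_prob \<omega> i j ^ m i j)
    = (\<Prod>i\<in>{1..n}. fact (n - 2) * (\<Prod>j\<in>{1..n} - {i}. fact (m i j))
        / fact ((\<Sum>j\<in>{1..n} - {i}. m i j) + (n - 1) - 1))"
proof (rule LIMSEQ_unique)
  show "(\<lambda>t. expectation (\<lambda>\<omega>. \<Prod>i\<in>{1..n}. row_ratio m t i \<omega>)) \<longlonglongrightarrow> (\<Prod>i\<in>{1..n}. fact (n - 2) * (\<Prod>j\<in>{1..n} - {i}. fact (m i j))
        / fact ((\<Sum>j\<in>{1..n} - {i}. m i j) + (n - 1) - 1))"
    by (simp only: expectation_prod_row_ratio tendsto_const)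
  have S: "(\<Sum>k\<in>{1..n} - {i}. weight V t i k \<omega>) \<ge> 1" if "i \<in> {1..n}" "\<omega> \<in> space M" for i t \<omega>
    using sum_weight_off_diag[OF that, of t] n2 by simp
  show "(\<lambda>t. expectation (\<lambda>\<omega>. \<Prod>i\<in>{1..n}. row_ratio m t i \<omega>)) \<longlonglongrightarrow>
      expectation (\<lambda>\<omega>. \<Prod>i\<in>{1..n}. \<Prod>j\<in>{1..n} - {i}. limit_prob \<omega> i j ^ m i j)"
  \<comment> \<open>The dominating constant is the product over the rows of the bounds in
    \<open>polya_ratio_bounds\<close>.\<close>
  proof (rule integral_dominated_convergence[where w = "\<lambda>_. \<Prod>i\<in>{1..n}. \<Prod>j\<in>{1..n} - {i}. fact (m i j)"])
    show "AE \<omega> in M. (\<lambda>t. \<Prod>i\<in>{1..n}. row_ratio m t i \<omega>) \<longlonglongrightarrow>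
        (\<Prod>i\<in>{1..n}. \<Prod>j\<in>{1..n} - {i}. limit_prob \<omega> i j ^ m i j)"
      using AE_visit_prob_tendsto AE_space
    proof eventually_elim
      case (elim \<omega>)
      show ?case
      proof (intro tendsto_prod tendsto_polya_ratio)
        fix i j assume i: "i \<in> {1..n}" and j: "j \<in> {1..n} - {i}"
        show "(\<lambda>t. weight V t i j \<omega> / (\<Sum>k\<in>{1..n} - {i}. weight V t i k \<omega>)) \<longlonglongrightarrow> limit_prob \<omega> i j"
          unfolding weight_off_diag_ratio[OF i elim(2)] using elim(1) i j by blast
      next
        fix i assume i: "i \<in> {1..n}"
        have "filterlim (\<lambda>t. n - 1 + t) at_top sequentially"
          by (rule filterlim_at_top_mono[OF filterlim_ident]) auto
        then have "filterlim (\<lambda>t. real (n - 1 + t)) at_top sequentially"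
          by (rule filterlim_compose[OF filterlim_real_sequentially])
        then show "filterlim (\<lambda>t. \<Sum>j\<in>{1..n} - {i}. weight V t i j \<omega>) at_top sequentially"
          using i elim by (simp only: sum_weight_off_diag)
      qed auto
    qed
    show "AE \<omega> in M. norm (\<Prod>i\<in>{1..n}. row_ratio m t i \<omega>) \<le> (\<Prod>i\<in>{1..n}. \<Prod>j\<in>{1..n} - {i}. fact (m i j))" for t
    proof (rule AE_I2)
      fix \<omega> assume w: "\<omega> \<in> space M"
      show "norm (\<Prod>i\<in>{1..n}. row_ratio m t i \<omega>) \<le> (\<Prod>i\<in>{1..n}. \<Prod>j\<in>{1..n} - {i}. fact (m i j))"
        unfolding prod_norm[symmetric]
      proof (intro prod_mono conjI)
        fix i assume i: "i \<in> {1..n}"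
        have "0 \<le> row_ratio m t i \<omega>" "row_ratio m t i \<omega> \<le> (\<Prod>j\<in>{1..n} - {i}. fact (m i j))"
          by (intro polya_ratio_bounds S i w weight_nonneg; simp)+
        then show "norm (row_ratio m t i \<omega>) \<le> (\<Prod>j\<in>{1..n} - {i}. fact (m i j))" by simp
      qed simp
    qed
    show "(\<lambda>\<omega>. \<Prod>i\<in>{1..n}. row_ratio m t i \<omega>) \<in> borel_measurable M" for t
      unfolding polya_ratio_def pochhammer_prod by measurable
  qed auto
qed

section \<open>Joint law of the limiting rows\<close>

lemma moments_remove_entry_limit_prob:
  "expectation (\<lambda>\<omega>. \<Prod>(i, j)\<in>{1..n} \<times> {1..n - 1}. limit_prob \<omega> i (insert_pos i j) ^ m (i, j))
    = (\<integral>x. (\<Prod>(i, j)\<in>{1..n} \<times> {1..n - 1}. x i j ^ m (i, j)) \<partial>Pi\<^sub>M {1..n} (\<lambda>_. dirichlet (n - 1) (\<lambda>_. 1)))"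
proof -
  let ?D = "dirichlet (n - 1) (\<lambda>_. 1)"
  have n1: "1 \<le> n - 1" using n2 by simp
  interpret D: prob_space ?D by (rule prob_space_dirichlet_ones[OF n1])
  interpret P: product_sigma_finite "\<lambda>_::nat. ?D" ..
  have [measurable_cong]: "sets ?D = sets (Pi\<^sub>M {1..n - 1} (\<lambda>_. borel))"
    by (simp add: dirichlet_def)
  \<comment> \<open>The exponents carried from positions 1, ..., n - 1 of a shortened row back to
    the players.\<close>
  define m' where "m' i l = m (i, remove_pos i l)" for i l
  have re: "(\<Prod>l\<in>{1..n} - {i}. g l (m' i l)) = (\<Prod>j\<in>{1..n - 1}. g (insert_pos i j) (m (i, j)))"
    if "i \<in> {1..n}" for i and g :: "nat \<Rightarrow> nat \<Rightarrow> real"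
    using prod.reindex_bij_betw[OF bij_betw_insert_pos[OF that], of "\<lambda>l. g l (m' i l)"]
    by (simp add: m'_def)
  have re_sum: "(\<Sum>l\<in>{1..n} - {i}. m' i l) = (\<Sum>j\<in>{1..n - 1}. m (i, j))" if "i \<in> {1..n}" for i
    using sum.reindex_bij_betw[OF bij_betw_insert_pos[OF that], of "\<lambda>l. m' i l"]
    by (simp add: m'_def)
  have "expectation (\<lambda>\<omega>. \<Prod>(i, j)\<in>{1..n} \<times> {1..n - 1}. limit_prob \<omega> i (insert_pos i j) ^ m (i, j))
      = expectation (\<lambda>\<omega>. \<Prod>i\<in>{1..n}. \<Prod>l\<in>{1..n} - {i}. limit_prob \<omega> i l ^ m' i l)"
    unfolding prod.cartesian_product[symmetric]
    by (intro Bochner_Integration.integral_cong refl prod.cong re[symmetric])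
  also have "\<dots> = (\<Prod>i\<in>{1..n}. fact (n - 2) * (\<Prod>l\<in>{1..n} - {i}. fact (m' i l))
        / fact ((\<Sum>l\<in>{1..n} - {i}. m' i l) + (n - 1) - 1))"
    by (rule expectation_limit_prob_monomial)
  also have "\<dots> = (\<Prod>i\<in>{1..n}. \<integral>x. (\<Prod>j\<in>{1..n - 1}. x j ^ m (i, j)) \<partial>?D)"
  proof (rule prod.cong[OF refl])
    fix i assume i: "i \<in> {1..n}"
    have "n - 1 - 1 = n - 2" by simp
    then show "fact (n - 2) * (\<Prod>l\<in>{1..n} - {i}. fact (m' i l))
        / fact ((\<Sum>l\<in>{1..n} - {i}. m' i l) + (n - 1) - 1) = (\<integral>x. (\<Prod>j\<in>{1..n - 1}. x j ^ m (i, j)) \<partial>?D)"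
      using integral_dirichlet_ones_monomial[OF n1, of "\<lambda>j. m (i, j)"]
      by (simp only: re[OF i, of "\<lambda>_. fact"] re_sum[OF i])
  qed
  \<comment> \<open>Fubini: the product of one-row Dirichlet moments is a mixed moment of the
    product measure.\<close>
  also have "\<dots> = (\<integral>x. (\<Prod>i\<in>{1..n}. \<Prod>j\<in>{1..n - 1}. x i j ^ m (i, j)) \<partial>Pi\<^sub>M {1..n} (\<lambda>_. ?D))"
  proof (rule P.product_integral_prod[symmetric])
    fix i
    show "integrable ?D (\<lambda>x. \<Prod>j\<in>{1..n - 1}. x j ^ m (i, j))"
    proof (rule D.integrable_bounded[of _ 1])
      show "AE x in ?D. \<bar>\<Prod>j\<in>{1..n - 1}. x j ^ m (i, j)\<bar> \<le> 1"
        using AE_dirichlet_ones_pos[OF n1] AE_dirichlet_ones_le_1[OF n1]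
      proof eventually_elim
        case (elim x)
        have "0 \<le> (\<Prod>j\<in>{1..n - 1}. x j ^ m (i, j))"
          using elim by (intro prod_nonneg zero_le_power) (auto intro: less_imp_le)
        moreover have "(\<Prod>j\<in>{1..n - 1}. x j ^ m (i, j)) \<le> 1"
          using elim by (intro prod_le_1 conjI power_le_one zero_le_power) (auto intro: less_imp_le)
        ultimately show ?case by simp
      qed
    qed measurable
  qed simp
  finally show ?thesis
    by (simp only: prod.cartesian_product)
qed

text \<open>The moment criterion works with one family of reals indexed by pairs. It identifies the
  law of the flattened matrix, and regrouping the coordinates into rows transports the equality to
  the nested product space.\<close>

lemma distr_remove_entry_limit_prob:
  "distr M (Pi\<^sub>M {1..n} (\<lambda>_. Pi\<^sub>M {1..n - 1} (\<lambda>_. borel))) (\<lambda>\<omega>. \<lambda>i\<in>{1..n}. remove_entry n i (limit_prob \<omega> i))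
    = Pi\<^sub>M {1..n} (\<lambda>_. dirichlet (n - 1) (\<lambda>_. 1))"
proof -
  let ?D = "dirichlet (n - 1) (\<lambda>_. 1)"
  let ?N = "Pi\<^sub>M {1..n} (\<lambda>_. ?D)"
  let ?K = "{1..n} \<times> {1..n - 1}"
  let ?R = "Pi\<^sub>M {1..n} (\<lambda>_. Pi\<^sub>M {1..n - 1} (\<lambda>_. borel :: real measure))"
  have n1: "1 \<le> n - 1" using n2 by simp
  have sets_D: "sets ?D = sets (Pi\<^sub>M {1..n - 1} (\<lambda>_. borel))"
    by (simp add: dirichlet_def)
  have sets_N: "sets ?N = sets ?R" by (intro sets_PiM_cong refl sets_D)
  have D: "prob_space ?D" by (rule prob_space_dirichlet_ones[OF n1])
  have N: "prob_space ?N" by (intro prob_space_PiM D)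
  define X where "X = (\<lambda>(i, j) \<omega>. limit_prob \<omega> i (insert_pos i j))"
  define Y where "Y = (\<lambda>(i :: nat, j :: nat) (x :: nat \<Rightarrow> nat \<Rightarrow> real). x i j)"
  have X: "X k \<in> borel_measurable M" if "k \<in> ?K" for k
    using that by (auto simp: X_def intro: measurable_limit_prob)
  have Y: "Y k \<in> borel_measurable ?N" if kK: "k \<in> ?K" for k
  proof -
    obtain i j where k: "k = (i, j)" "i \<in> {1..n}" "j \<in> {1..n - 1}"
      using kK by blast
    have "(\<lambda>x. x i j) \<in> borel_measurable ?R"
      by (rule measurable_compose[OF measurable_component_singleton[OF k(2)] measurable_component_singleton[OF k(3)]])
    then show ?thesis
      unfolding k(1) Y_def by (simp only: measurable_cong_sets[OF sets_N refl] prod.case)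
  qed
  have X01: "AE \<omega> in M. X k \<omega> \<in> {0..1}" if kK: "k \<in> ?K" for k
  proof -
    obtain i j where k: "k = (i, j)" "i \<in> {1..n}" "j \<in> {1..n - 1}"
      using kK by blast
    have "insert_pos i j \<in> {1..n}" using bij_betw_apply[OF bij_betw_insert_pos[OF k(2)] k(3)] by blast
    then show ?thesis unfolding k(1) X_def using AE_limit_prob_unit[OF k(2)] by simp
  qed
  have Y01: "AE x in ?N. Y k x \<in> {0..1}" if kK: "k \<in> ?K" for k
  proof -
    obtain i j where k: "k = (i, j)" "i \<in> {1..n}" "j \<in> {1..n - 1}"
      using kK by blast
    have "AE x in ?D. x j \<in> {0..1}"
      using AE_dirichlet_ones_pos[OF n1] AE_dirichlet_ones_le_1[OF n1]
      by eventually_elim (use k(3) in \<open>auto intro: less_imp_le\<close>)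
    from AE_PiM_component[OF D k(2) this] show ?thesis by (simp add: k(1) Y_def)
  qed
  have moments: "expectation (\<lambda>\<omega>. \<Prod>k\<in>?K. X k \<omega> ^ m k) = (\<integral>x. (\<Prod>k\<in>?K. Y k x ^ m k) \<partial>?N)" for m
    using moments_remove_entry_limit_prob[of m] by (simp add: X_def Y_def case_prod_unfold)
  have eq: "distr M (Pi\<^sub>M ?K (\<lambda>_. borel)) (\<lambda>\<omega>. \<lambda>k\<in>?K. X k \<omega>) = distr ?N (Pi\<^sub>M ?K (\<lambda>_. borel)) (\<lambda>x. \<lambda>k\<in>?K. Y k x)"
    by (rule distr_eq_PiM_borel_moments[OF prob_space_axioms N _ X X01 Y Y01 moments]) simp
  \<comment> \<open>The measurable regrouping from pairs back to rows.\<close>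
  define rows where "rows x = (\<lambda>i\<in>{1..n}. \<lambda>j\<in>{1..n - 1}. x (i, j))" for x :: "nat \<times> nat \<Rightarrow> real"
  have rows: "rows \<in> Pi\<^sub>M ?K (\<lambda>_. borel) \<rightarrow>\<^sub>M ?R"
    unfolding rows_def[abs_def] by (intro measurable_restrict measurable_component_singleton) auto
  have "distr M ?R (\<lambda>\<omega>. \<lambda>i\<in>{1..n}. remove_entry n i (limit_prob \<omega> i)) = distr M ?R (\<lambda>\<omega>. rows (\<lambda>k\<in>?K. X k \<omega>))"
    by (intro distr_cong refl) (auto simp: rows_def X_def remove_entry_eq fun_eq_iff restrict_def)
  also have "\<dots> = distr (distr M (Pi\<^sub>M ?K (\<lambda>_. borel)) (\<lambda>\<omega>. \<lambda>k\<in>?K. X k \<omega>)) ?R rows"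
    using X by (subst distr_distr[OF rows]) (auto simp: comp_def intro!: measurable_restrict)
  also have "\<dots> = distr (distr ?N (Pi\<^sub>M ?K (\<lambda>_. borel)) (\<lambda>x. \<lambda>k\<in>?K. Y k x)) ?R rows"
    by (simp only: eq)
  also have "\<dots> = distr ?N ?R (\<lambda>x. rows (\<lambda>k\<in>?K. Y k x))"
    using Y by (subst distr_distr[OF rows]) (auto simp: comp_def intro!: measurable_restrict)
  also have "\<dots> = distr ?N ?N (\<lambda>x. x)"
  proof (rule distr_cong[OF refl])
    fix x assume "x \<in> space ?N"
    then have "x \<in> space ?R" using sets_eq_imp_space_eq[OF sets_N] by simp
    then have x: "x \<in> extensional {1..n}" "\<And>i. i \<in> {1..n} \<Longrightarrow> x i \<in> extensional {1..n - 1}"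
      by (auto simp: space_PiM PiE_iff)
    show "rows (\<lambda>k\<in>?K. Y k x) = x"
    \<comment> \<open>Flattening and regrouping is the identity because points of the product space
      are \<open>undefined\<close> outside the index sets, at both levels.\<close>
    proof (intro ext)
      fix i j
      show "rows (\<lambda>k\<in>?K. Y k x) i j = x i j"
        using extensional_arb[OF x(1), of i] extensional_arb[OF x(2), of i j]
        by (auto simp: rows_def Y_def)
    qed
  qed (simp only: sets_N)
  finally show ?thesis by simp
qed

lemma measurable_remove_entry_limit_prob:
  assumes "i \<in> {1..n}"
  shows "(\<lambda>\<omega>. remove_entry n i (limit_prob \<omega> i)) \<in> M \<rightarrow>\<^sub>M Pi\<^sub>M {1..n - 1} (\<lambda>_. borel)"
  unfolding remove_entry_eq by (intro measurable_restrict measurable_limit_prob[OF assms])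

lemma distr_remove_entry_limit_prob_row:
  assumes i: "i \<in> {1..n}"
  shows "distr M (Pi\<^sub>M {1..n - 1} (\<lambda>_. borel)) (\<lambda>\<omega>. remove_entry n i (limit_prob \<omega> i)) = dirichlet (n - 1) (\<lambda>_. 1)"
proof -
  let ?D = "dirichlet (n - 1) (\<lambda>_. 1)"
  let ?B = "Pi\<^sub>M {1..n - 1} (\<lambda>_. borel :: real measure)"
  have sets_D: "sets ?D = sets ?B" by (simp add: dirichlet_def)
  have "distr M ?B (\<lambda>\<omega>. remove_entry n i (limit_prob \<omega> i))
      = distr (distr M (Pi\<^sub>M {1..n} (\<lambda>_. ?B)) (\<lambda>\<omega>. \<lambda>i\<in>{1..n}. remove_entry n i (limit_prob \<omega> i))) ?B (\<lambda>x. x i)"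
    using i
    by (subst distr_distr)
      (auto simp: comp_def simp del: One_nat_def intro!: measurable_restrict measurable_remove_entry_limit_prob)
  also have "\<dots> = distr (Pi\<^sub>M {1..n} (\<lambda>_. ?D)) ?D (\<lambda>x. x i)"
    unfolding distr_remove_entry_limit_prob by (intro distr_cong refl) (simp only: sets_D)
  also have "\<dots> = ?D"
    using n2 i by (intro distr_PiM_component prob_space_dirichlet_ones) auto
  finally show ?thesis .
qed

text \<open>The joint law of the shortened rows is the product of its marginals, so these rows are
  independent; each full row is a measurable function of its own shortened row, obtained by putting
  back the zero at the diagonal.\<close>

lemma indep_rows_limit_prob:
  "indep_vars (\<lambda>_. Pi\<^sub>M {1..n} (\<lambda>_. borel)) (\<lambda>i \<omega>. restrict (limit_prob \<omega> i) {1..n}) {1..n}"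
proof -
  let ?B = "Pi\<^sub>M {1..n - 1} (\<lambda>_. borel :: real measure)"
  have "indep_vars (\<lambda>_. ?B) (\<lambda>i \<omega>. remove_entry n i (limit_prob \<omega> i)) {1..n}"
  proof (subst indep_vars_iff_distr_eq_PiM')
    show "distr M (Pi\<^sub>M {1..n} (\<lambda>_. ?B)) (\<lambda>\<omega>. \<lambda>i\<in>{1..n}. remove_entry n i (limit_prob \<omega> i))
      = Pi\<^sub>M {1..n} (\<lambda>i. distr M ?B (\<lambda>\<omega>. remove_entry n i (limit_prob \<omega> i)))"
      unfolding distr_remove_entry_limit_prob
      by (intro PiM_cong refl distr_remove_entry_limit_prob_row[symmetric])
  qed (use n2 measurable_remove_entry_limit_prob in auto)
  \<comment> \<open>The map that restores the diagonal zero of row i.\<close>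
  moreover have "(\<lambda>x. \<lambda>l\<in>{1..n}. if l = i then 0 else x (remove_pos i l)) \<in> ?B \<rightarrow>\<^sub>M Pi\<^sub>M {1..n} (\<lambda>_. borel)"
    if i: "i \<in> {1..n}" for i
  proof (rule measurable_restrict)
    fix l assume l: "l \<in> {1..n}"
    show "(\<lambda>x. if l = i then 0 else x (remove_pos i l)) \<in> borel_measurable ?B"
    proof (cases "l = i")
      case False
      then have "remove_pos i l \<in> {1..n - 1}" using i l by (auto simp: remove_pos_def)
      then show ?thesis using False by simp
    qed simp
  qed
  ultimately have indep: "indep_vars (\<lambda>_. Pi\<^sub>M {1..n} (\<lambda>_. borel))
      (\<lambda>i \<omega>. \<lambda>l\<in>{1..n}. if l = i then 0 else remove_entry n i (limit_prob \<omega> i) (remove_pos i l)) {1..n}"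
    by (rule indep_vars_compose2)
  have eq: "(\<lambda>l\<in>{1..n}. if l = i then 0 else remove_entry n i (limit_prob \<omega> i) (remove_pos i l))
      = restrict (limit_prob \<omega> i) {1..n}" if i: "i \<in> {1..n}" for i \<omega>
  proof (rule restrict_ext)
    fix l assume l: "l \<in> {1..n}"
    show "(if l = i then 0 else remove_entry n i (limit_prob \<omega> i) (remove_pos i l)) = limit_prob \<omega> i l"
    proof (cases "l = i")
      case False
      then have "remove_pos i l \<in> {1..n - 1}" "insert_pos i (remove_pos i l) = l"
        using i l by (auto simp: remove_pos_def insert_pos_def)
      then show ?thesis using False by (simp add: remove_entry_eq del: One_nat_def)
    qed (simp add: limit_prob_def)
  qed
  show ?thesis
    using indep by (subst indep_vars_cong[OF refl ext[OF eq[symmetric]] refl])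
qed

end

end

theorem theorem1:
  fixes M :: "'a measure" and n :: nat and V :: "nat \<Rightarrow> nat \<Rightarrow> 'a \<Rightarrow> nat"
  assumes "n \<ge> 2" and "friends_I M n V"
  shows "\<exists>P :: 'a \<Rightarrow> nat \<Rightarrow> nat \<Rightarrow> real.
      (\<forall>i\<in>{1..n}. \<forall>j\<in>{1..n}. (\<lambda>\<omega>. P \<omega> i j) \<in> borel_measurable M) \<and>
      (AE \<omega> in M. \<forall>i\<in>{1..n}. \<forall>j\<in>{1..n}. (\<lambda>t. visit_prob n V t i j \<omega>) \<longlonglongrightarrow> P \<omega> i j) \<and>
      (AE \<omega> in M. \<forall>i\<in>{1..n}. P \<omega> i i = 0) \<and>
      prob_space.indep_vars M (\<lambda>_. Pi\<^sub>M {1..n} (\<lambda>_. borel))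
        (\<lambda>i \<omega>. restrict (P \<omega> i) {1..n}) {1..n} \<and>
      (\<forall>i\<in>{1..n}. distr M (Pi\<^sub>M {1..n - 1} (\<lambda>_. borel)) (\<lambda>\<omega>. remove_entry n i (P \<omega> i))
        = dirichlet (n - 1) (\<lambda>_. 1))"
proof -
  interpret friends_I M n V by fact
  show ?thesis
  proof (intro exI[of _ limit_prob] conjI ballI)
    show "AE \<omega> in M. \<forall>i\<in>{1..n}. limit_prob \<omega> i i = 0"
      by (simp add: limit_prob_def)
  next
    show "indep_vars (\<lambda>_. Pi\<^sub>M {1..n} (\<lambda>_. borel)) (\<lambda>i \<omega>. restrict (limit_prob \<omega> i) {1..n}) {1..n}"
      by (rule indep_rows_limit_prob[OF assms(1)])
  qed (use AE_visit_prob_tendsto[OF assms(1)] distr_remove_entry_limit_prob_row[OF assms(1)] in auto)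
qed

end
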